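(* Let $X,Y$ be real Banach spaces, let $U\subset X$ be open and convex, let $1\leq p\leq\infty$, and let $f:U\to Y$ be a mapping. Then the following assertions are equivalent: (a) $f$ is differentiable, $f'$ takes $U$-bounded sets into uniformly $p$-convergent subsets of $L(X,Y)$, and $f$ is weakly $p$-sequentially continuous. (b) There exist a Banach space $Z$, an operator $S\in C_p(X,Z)$ and a mapping $g:S(U)\to Y$ such that: (i) $f(x)=g(S(x))$ for all $x\in U$; (ii) $g\in D_{\mathcal M}(S(x),Y)$ for every $x\in U$, where $\mathcal M:=\{S(B): B \text{ is a } U\text{-bounded subset of } X\}$; (iii) $g'$ is bounded on $S(B)$ for every $U$-bounded subset $B\subset X$. Moreover, if this factorization holds, then $f$ is weakly $p$-sequentially continuous.
   Context: $L(X,Y)$ is the space of bounded linear operators $X\to Y$. For $1\le p<\infty$, a sequence $(x_n)_n$ in $X$ is weakly $p$-summable if $(x^*(x_n))_n\in\ell_p$ for every $x^*\in X^*$; for $p=\infty$, "weakly $\infty$-summable" means weakly null. $\ell_p^w(X)$ denotes the set of weakly $p$-summable sequences. A sequence $(x_n)_n$ is weakly $p$-Cauchy if $(x_{m_k}-x_{n_k})_k\in\ell_p^w(X)$ for all increasing sequences $(m_k)_k,(n_k)_k$ of positive integers. $C_p(X,Z)$ is the space of $p$-convergent operators, i.e. $T\in L(X,Z)$ with $\|T(x_n)\|\to0$ for all $(x_n)_n\in\ell_p^w(X)$. A set $K\subset L(X,Y)$ is uniformly $p$-convergent if $\lim_n\sup_{T\in K}\|T(x_n)\|=0$ for every $(x_n)_n\in\ell_p^w(X)$.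 A set $B\subset U$ is $U$-bounded if it is bounded and the distance between $B$ and the boundary of $U$ is strictly positive (this last condition is vacuous if $U=X$); a sequence is $U$-bounded if the set of its terms is. A map $f:U\to Y$ is weakly $p$-sequentially continuous if it takes $U$-bounded and weakly $p$-Cauchy sequences of $U$ into norm convergent sequences in $Y$. "Differentiable" means Fréchet differentiable, with derivative $f':U\to L(X,Y)$. $\mathcal M$-differentiability: given a map $g$ with values in $Y$ defined on a subset $D$ of a Banach space $Z$, a point $z\in D$, and a class $\mathcal M$ of subsets of $Z$ such that for each $A\in\mathcal M$ one has $z+\varepsilon a\in D$ for all $a\in A$ and all sufficiently small $|\varepsilon|$, one writes $g\in D_{\mathcal M}(z,Y)$ if there exists an operator $g'(z)\in L(Z,Y)$ such that $\lim_{\varepsilon\to0}\frac{g(z+\varepsilon y)-g(z)-g'(z)(\varepsilon y)}{\varepsilon}=0$ uniformly for $y$ in each member of $\mathcal M$. In (b), $D=S(U)$ and $g'$ denotes the map $S(x)\mapsto g'(S(x))\in L(Z,Y)$ given by (ii).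
   Formalization: With B ⊂ U in 𝓜, (b)⇒(a) can fail if 0 ∉ U. The equivalence is proved with B in 𝓜 any bounded subset of X at positive distance from the boundary of U; with B ⊂ U, (b)⇒(a) is proved for 0 ∈ U, while (a)⇒(b) and the "Moreover" hold for every U. *)

theory Defs
  imports "HOL-Analysis.Analysis" "HOL-Probability.Discrete_Topology"
begin

section \<open>Weak p-summability and p-convergence\<close>

definition weakly_p_summable :: "ereal \<Rightarrow> (nat \<Rightarrow> 'a::real_normed_vector) \<Rightarrow> bool" where
  "weakly_p_summable p x \<longleftrightarrow>
     (if p = \<infinity> then \<forall>\<phi> :: 'a \<Rightarrow>\<^sub>L real. (\<lambda>n. blinfun_apply \<phi> (x n)) \<longlonglongrightarrow> 0
      else \<forall>\<phi> :: 'a \<Rightarrow>\<^sub>L real. summable (\<lambda>n. \<bar>blinfun_apply \<phi> (x n)\<bar> powr real_of_ereal p))"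

definition weakly_p_Cauchy :: "ereal \<Rightarrow> (nat \<Rightarrow> 'a::real_normed_vector) \<Rightarrow> bool" where
  "weakly_p_Cauchy p x \<longleftrightarrow>
     (\<forall>m n. strict_mono m \<longrightarrow> strict_mono n \<longrightarrow> weakly_p_summable p (\<lambda>k. x (m k) - x (n k)))"

definition p_convergent ::
  "ereal \<Rightarrow> ('a::real_normed_vector \<Rightarrow>\<^sub>L 'z::real_normed_vector) \<Rightarrow> bool" where
  "p_convergent p T \<longleftrightarrow>
     (\<forall>x. weakly_p_summable p x \<longrightarrow> (\<lambda>n. norm (blinfun_apply T (x n))) \<longlonglongrightarrow> 0)"

text \<open>The supremum is taken in \<^typ>\<open>ennreal\<close>, as no boundedness of \<open>K\<close> is presupposed.\<close>

definition uniformly_p_convergent ::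
  "ereal \<Rightarrow> ('a::real_normed_vector \<Rightarrow>\<^sub>L 'b::real_normed_vector) set \<Rightarrow> bool" where
  "uniformly_p_convergent p K \<longleftrightarrow>
     (\<forall>x. weakly_p_summable p x \<longrightarrow>
        (\<lambda>n. SUP T\<in>K. ennreal (norm (blinfun_apply T (x n)))) \<longlonglongrightarrow> 0)"


section \<open>U-bounded sets\<close>

text \<open>\<^const>\<open>setdist\<close> is \<open>0\<close> as soon as one of its arguments is empty, whereas the condition on
  the distance to the boundary is vacuous in these cases.\<close>

definition bounded_off_boundary :: "'a::real_normed_vector set \<Rightarrow> 'a set \<Rightarrow> bool" where
  "bounded_off_boundary U B \<longleftrightarrow>
     bounded B \<and> (B = {} \<or> frontier U = {} \<or> setdist B (frontier U) > 0)"

definition U_bounded :: "'a::real_normed_vector set \<Rightarrow> 'a set \<Rightarrow> bool" where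
  "U_bounded U B \<longleftrightarrow> B \<subseteq> U \<and> bounded_off_boundary U B"

definition weakly_p_sequentially_continuous ::
  "ereal \<Rightarrow> 'a::real_normed_vector set \<Rightarrow> ('a \<Rightarrow> 'b::real_normed_vector) \<Rightarrow> bool" where
  "weakly_p_sequentially_continuous p U f \<longleftrightarrow>
     (\<forall>x. U_bounded U (range x) \<longrightarrow> weakly_p_Cauchy p x \<longrightarrow> convergent (\<lambda>n. f (x n)))"


section \<open>Operators on a subspace, and differentiability with respect to a class of sets\<close>

text \<open>Banach spaces \<open>Z\<close> over which one has to quantify existentially are represented as closed
  linear subspaces of a type of class \<^class>\<open>banach\<close>. A map defined on a subset of such
  a space is a total function whose values elsewhere are irrelevant; in particular, the elements of
  \<open>L(Z,Y)\<close> are functions that are linear and bounded on \<open>Z\<close>.\<close>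

definition bounded_linear_on ::
  "'z::real_normed_vector set \<Rightarrow> ('z \<Rightarrow> 'b::real_normed_vector) \<Rightarrow> bool" where
  "bounded_linear_on Z T \<longleftrightarrow>
     (\<forall>u\<in>Z. \<forall>v\<in>Z. T (u + v) = T u + T v) \<and>
     (\<forall>c. \<forall>u\<in>Z. T (c *\<^sub>R u) = c *\<^sub>R T u) \<and>
     (\<exists>C. \<forall>u\<in>Z. norm (T u) \<le> C * norm u)"

text \<open>\<open>has_M_derivative Z D M g z T\<close>: the map \<open>g\<close>, defined on \<open>D\<close>, belongs to
  \<open>D\<^sub>M(z,Y)\<close>, with \<open>g'(z) = T \<in> L(Z,Y)\<close>.\<close>

definition has_M_derivative ::
  "'z::real_normed_vector set \<Rightarrow> 'z set \<Rightarrow> 'z set set \<Rightarrow> ('z \<Rightarrow> 'b::real_normed_vector) \<Rightarrow>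
   'z \<Rightarrow> ('z \<Rightarrow> 'b) \<Rightarrow> bool" where
  "has_M_derivative Z D M g z T \<longleftrightarrow>
     bounded_linear_on Z T \<and>
     (\<forall>A\<in>M. (\<forall>\<^sub>F \<epsilon> in at (0::real). \<forall>a\<in>A. z + \<epsilon> *\<^sub>R a \<in> D) \<and>
        uniform_limit A
          (\<lambda>\<epsilon> y. (g (z + \<epsilon> *\<^sub>R y) - g z - T (\<epsilon> *\<^sub>R y)) /\<^sub>R \<epsilon>) (\<lambda>_. 0) (at 0))"


section \<open>The two assertions\<close>

definition assertion_a ::
  "ereal \<Rightarrow> 'a::real_normed_vector set \<Rightarrow> ('a \<Rightarrow> 'b::real_normed_vector) \<Rightarrow> bool" where
  "assertion_a p U f \<longleftrightarrow>
     (\<exists>f' :: 'a \<Rightarrow> 'a \<Rightarrow>\<^sub>L 'b.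
        (\<forall>x\<in>U. (f has_derivative blinfun_apply (f' x)) (at x)) \<and>
        (\<forall>B. U_bounded U B \<longrightarrow> uniformly_p_convergent p (f' ` B))) \<and>
     weakly_p_sequentially_continuous p U f"

text \<open>
  The factorization of \<open>f\<close> through a closed subspace \<open>Z\<close> of \<open>'z\<close>, where the derivatives are taken
  with respect to \<open>M = {S(B) | B \<in> \<B>}\<close>.

  If \<open>\<B>\<close> consists of the sets \<open>B \<subseteq> U\<close> that are \<open>U\<close>-bounded and \<open>0 \<notin> U\<close>, then the
  differentiability of \<open>g\<close> gives no information on \<open>f\<close> in the directions outside the cones spanned
  by \<open>U\<close> and \<open>- U\<close>, and the factorization does not imply that \<open>f\<close> is differentiable.
  For instance, let \<open>X = Z\<close> be the Euclidean plane, \<open>S = id\<close>, \<open>c = (10,0)\<close>, \<open>U = ball c 1\<close> and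
  \<open>f(x) = g(x) = F(x - c)\<close>, where \<open>F\<close> is a nonzero real function, smooth off the origin, positively
  homogeneous of degree 1, and zero on \<open>{(s,t). \<bar>t\<bar> \<le> \<bar>s\<bar>}\<close>. So the family \<open>\<B>\<close> is a parameter,
  for which two choices are relevant:
  the \<open>U\<close>-bounded subsets of \<open>U\<close>, i.e. \<open>{B. U_bounded U B}\<close>; and the bounded subsets of the whole
  space \<open>X\<close> that are at a positive distance from the boundary of \<open>U\<close>,
  i.e. \<open>{B. bounded_off_boundary U B}\<close>.
\<close>

definition factorizes ::
  "'z::banach itself \<Rightarrow> 'a::banach set set \<Rightarrow> ereal \<Rightarrow> 'a set \<Rightarrow> ('a \<Rightarrow> 'b::banach) \<Rightarrow> bool" where
  "factorizes _ \<B> p U f \<longleftrightarrow>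
     (\<exists>(Z :: 'z set) (S :: 'a \<Rightarrow>\<^sub>L 'z) (g :: 'z \<Rightarrow> 'b) (g' :: 'z \<Rightarrow> 'z \<Rightarrow> 'b).
        subspace Z \<and> closed Z \<and> range (blinfun_apply S) \<subseteq> Z \<and> p_convergent p S \<and>
        (\<forall>x\<in>U. f x = g (blinfun_apply S x)) \<and>
        (\<forall>x\<in>U. has_M_derivative Z (blinfun_apply S ` U) ((\<lambda>B. blinfun_apply S ` B) ` \<B>) g
                  (blinfun_apply S x) (g' (blinfun_apply S x))) \<and>
        (\<forall>B. U_bounded U B \<longrightarrow>
           (\<exists>C. \<forall>z \<in> blinfun_apply S ` B. \<forall>w\<in>Z. norm (g' z w) \<le> C * norm w)))"

text \<open>The Banach space \<open>\<ell>\<^sub>\<infinity>(X;Y)\<close> of bounded functions from \<open>X\<close> to \<open>Y\<close>, with the supremum norm.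
  It is the space in which the existence of \<open>Z\<close> is claimed, types not being quantifiable; in the
  converse direction \<open>Z\<close> lives in an arbitrary type of class \<^class>\<open>banach\<close>.\<close>

instance bcontfun :: (metric_space, banach) banach ..

type_synonym ('a, 'b) linf = "'a discrete \<Rightarrow>\<^sub>C 'b"

end

theory Submission
  imports Defs
begin

text \<open>
  Exhaust \<open>U\<close> by the convex \<open>U\<close>-bounded sets \<open>U\<^sub>n\<close> of the points of norm at most \<open>n\<close> at distance at
  least \<open>1 / (n + 1)\<close> from the complement of \<open>U\<close>.

  From (a) to (b): the sets \<open>f'(U\<^sub>n)\<close> are bounded, since a uniformly \<open>p\<close>-convergent set is.
  The operator \<open>S\<close> sends \<open>h\<close> to the function \<open>x \<mapsto> f'(x) h\<close>, damped by a weight that depends on the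
  least \<open>n\<close> with \<open>x \<in> U\<^sub>n\<close>. It is \<open>p\<close>-convergent, because weakly \<open>p\<close>-summable sequences are bounded
  (by Hahn-Banach and Baire). If \<open>S(x) = S(y)\<close> then all derivatives vanish at \<open>x - y\<close>, so
  \<open>f(x) = f(y)\<close>, and \<open>g\<close> is well defined.

  From (b) to (a): the key is the estimate \<open>\<parallel>f(y) - f(x)\<parallel> \<le> C \<parallel>S(y - x)\<parallel>\<close> on \<open>U\<close>-bounded sets. It is
  not a direct consequence of the mean value theorem, since \<open>g\<close> is only known to be differentiable in
  the directions of \<open>S(U)\<close>; a maximum principle in a plane spanned by two admissible directions
  replaces it. The estimate gives weak sequential continuity at once, and it allows one to
  approximate the directions that the sets in \<open>M\<close> miss by those that they contain, which yields
  Frechet differentiability.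
\<close>

section \<open>The Hahn-Banach theorem and weakly summable sequences\<close>

text \<open>Homogeneity is only an inequality for t > 0, since in this form it passes easily to
  infima; equality and \<open>q 0 = 0\<close> follow by also using the inverse factor.\<close>

definition sublinear :: "('a::real_vector \<Rightarrow> real) \<Rightarrow> bool" where
  "sublinear q \<longleftrightarrow> (\<forall>x y. q (x + y) \<le> q x + q y) \<and> (\<forall>t>0. \<forall>x. q (t *\<^sub>R x) \<le> t * q x)"

lemma sublinear_add: "sublinear q \<Longrightarrow> q (x + y) \<le> q x + q y"
  by (simp add: sublinear_def)

lemma sublinear_scaleR_le: "sublinear q \<Longrightarrow> 0 < t \<Longrightarrow> q (t *\<^sub>R x) \<le> t * q x"
  by (simp add: sublinear_def)

lemma sublinear_zero:
  assumes "sublinear q" shows "q 0 = 0"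
  using sublinear_scaleR_le[OF assms, of 2 0] sublinear_scaleR_le[OF assms, of "1/2" 0] by simp

lemma sublinear_scaleR:
  assumes "sublinear q" "0 \<le> t" shows "q (t *\<^sub>R x) = t * q x"
proof (cases "t = 0")
  case True
  then show ?thesis by (simp add: sublinear_zero[OF assms(1)])
next
  case False
  then have t: "0 < t" using assms by simp
  have "q x \<le> inverse t * q (t *\<^sub>R x)"
    using sublinear_scaleR_le[OF assms(1), of "inverse t" "t *\<^sub>R x"] t by simp
  then have "t * q x \<le> q (t *\<^sub>R x)"
    using t by (simp add: field_simps)
  then show ?thesis using sublinear_scaleR_le[OF assms(1) t, of x] by simp
qed

lemma sublinear_minus: "sublinear q \<Longrightarrow> - q (- x) \<le> q x"
  using sublinear_add[of q x "- x"] sublinear_zero[of q] by simp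

lemma sublinear_norm: "sublinear (norm :: 'a::real_normed_vector \<Rightarrow> real)"
  by (simp add: sublinear_def norm_triangle_ineq)

text \<open>The witness is the largest sublinear function below \<open>q\<close> with value at most
  \<open>- c\<close> at \<open>- a\<close>; the bound on \<open>c\<close> keeps its infimum finite.
  It serves to show that minimal sublinear functions are odd, and to prescribe the value of a
  functional at one vector.\<close>

lemma sublinear_improve:
  assumes q: "sublinear q" and c: "c \<le> q a"
  obtains r where "sublinear r" "\<And>x. r x \<le> q x" "r (- a) \<le> - c"
proof -
  define r where "r x = (INF t\<in>{0..}. q (x + t *\<^sub>R a) - t * c)" for x
  have lower: "- q (- x) \<le> q (x + t *\<^sub>R a) - t * c" if "t \<ge> 0" for x t
    using sublinear_add[OF q, of "x + t *\<^sub>R a" "- x"] sublinear_scaleR[OF q that, of a]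
      mult_left_mono[OF c that] by simp
  then have bdd: "bdd_below ((\<lambda>t. q (x + t *\<^sub>R a) - t * c) ` {0..})" for x
    by (auto intro!: bdd_belowI2)
  have le: "r x \<le> q (x + t *\<^sub>R a) - t * c" if "t \<ge> 0" for x t
    unfolding r_def by (rule cINF_lower[OF bdd]) (use that in simp)
  have greatest: "l \<le> r x" if "\<And>t. t \<ge> 0 \<Longrightarrow> l \<le> q (x + t *\<^sub>R a) - t * c" for l x
    unfolding r_def by (rule cINF_greatest) (use that in auto)
  have "r (x + y) \<le> r x + r y" for x y
  proof -
    have *: "r (x + y) \<le> (q (x + t *\<^sub>R a) - t * c) + (q (y + s *\<^sub>R a) - s * c)" if "t \<ge> 0" "s \<ge> 0" for t s
      using le[of "t + s" "x + y"] that sublinear_add[OF q, of "x + t *\<^sub>R a" "y + s *\<^sub>R a"]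
      by (simp add: algebra_simps)
    have "r (x + y) - (q (x + t *\<^sub>R a) - t * c) \<le> r y" if "t \<ge> 0" for t
      by (rule greatest) (use * that in force)
    then have "r (x + y) - r y \<le> r x"
      by (intro greatest) force
    then show ?thesis by simp
  qed
  moreover have "r (t *\<^sub>R x) \<le> t * r x" if t: "t > 0" for t x
  proof -
    have "inverse t * r (t *\<^sub>R x) \<le> q (x + s *\<^sub>R a) - s * c" if "s \<ge> 0" for s
    proof -
      have "r (t *\<^sub>R x) \<le> t * (q (x + s *\<^sub>R a) - s * c)"
        using le[of "t * s" "t *\<^sub>R x"] t that sublinear_scaleR[OF q, of t "x + s *\<^sub>R a"]
        by (simp add: algebra_simps)
      then show ?thesis using t by (simp add: field_simps)
    qed
    then have "inverse t * r (t *\<^sub>R x) \<le> r x" by (rule greatest)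
    then show ?thesis using t by (simp add: field_simps)
  qed
  ultimately have "sublinear r" by (simp add: sublinear_def)
  moreover have "r x \<le> q x" for x using le[of 0 x] by simp
  moreover have "r (- a) \<le> - c" using le[of 1 "- a"] sublinear_zero[OF q] by simp
  ultimately show ?thesis using that by blast
qed

text \<open>A minimal sublinear function below \<open>q0\<close>, provided by Zorn's lemma, is odd
  because \<open>sublinear_improve\<close> cannot lower it any further; an odd sublinear function is
  linear.\<close>

lemma sublinear_dominates_linear:
  assumes q0: "sublinear q0"
  obtains l where "linear l" "\<And>x. l x \<le> q0 x"
proof -
  define A where "A = {q. sublinear q \<and> (\<forall>x. q x \<le> q0 x)}"
  \<comment> \<open>The order is reversed, so that Zorn's maximal element is a pointwise minimal
    function.\<close>
  define P :: "('a \<Rightarrow> real) \<Rightarrow> ('a \<Rightarrow> real) \<Rightarrow> bool" where "P q r \<longleftrightarrow> (\<forall>x. r x \<le> q x)" for q r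
  have "partial_order_on A (relation_of P A)"
    by (rule partial_order_on_relation_ofI) (auto simp: P_def intro: order.trans intro!: ext order.antisym)
  moreover have "\<exists>u\<in>A. \<forall>a\<in>C. P a u" if C: "C \<in> Chains (relation_of P A)" for C
  proof (cases "C = {}")
    case True
    then show ?thesis using q0 by (auto simp: A_def)
  next
    case False
    have CA: "q \<in> A" if "q \<in> C" for q
      using C that by (auto simp: Chains_def relation_of_def)
    have chain: "P q r \<or> P r q" if "q \<in> C" "r \<in> C" for q r
      using C that by (auto simp: Chains_def relation_of_def)
    define u where "u x = (INF q\<in>C. q x)" for x
    \<comment> \<open>A lower bound common to the whole chain, from
      \<open>- q0 (- x) \<le> - q (- x) \<le> q x\<close>, makes the infimum finite.\<close>
    have "- q0 (- x) \<le> q x" if "q \<in> C" for x q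
      using CA[OF that] sublinear_minus[of q x] unfolding A_def by (smt (verit) mem_Collect_eq)
    then have bdd: "bdd_below ((\<lambda>q. q x) ` C)" for x
      by (auto intro!: bdd_belowI2)
    have le: "u x \<le> q x" if "q \<in> C" for q x
      unfolding u_def by (rule cINF_lower[OF bdd that])
    have greatest: "m \<le> u x" if "\<And>q. q \<in> C \<Longrightarrow> m \<le> q x" for m x
      unfolding u_def by (rule cINF_greatest[OF False that])
    have "u (x + y) \<le> u x + u y" for x y
    proof -
      \<comment> \<open>The smaller of the chain members \<open>q\<close> and \<open>r\<close> is
        used for both summands.\<close>
      have *: "u (x + y) \<le> q x + r y" if qr: "q \<in> C" "r \<in> C" for q r
      proof -
        have "q (x + y) \<le> q x + q y" "r (x + y) \<le> r x + r y"
          using CA qr by (auto simp: A_def sublinear_def)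
        then show ?thesis
          using chain[OF qr] le[OF qr(1), of "x + y"] le[OF qr(2), of "x + y"]
          unfolding P_def by (smt (verit))
      qed
      have "u (x + y) - q x \<le> u y" if "q \<in> C" for q
        by (rule greatest) (use * that in force)
      then have "u (x + y) - u y \<le> u x"
        by (intro greatest) force
      then show ?thesis by simp
    qed
    moreover have "u (t *\<^sub>R x) \<le> t * u x" if t: "t > 0" for t x
    proof -
      have "inverse t * u (t *\<^sub>R x) \<le> q x" if "q \<in> C" for q
      proof -
        have "u (t *\<^sub>R x) \<le> t * q x"
          using le[OF that, of "t *\<^sub>R x"] sublinear_scaleR_le[OF _ t, of q x] CA[OF that]
          by (simp add: A_def)
        then show ?thesis using t by (simp add: field_simps)
      qed
      then have "inverse t * u (t *\<^sub>R x) \<le> u x" by (rule greatest)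
      then show ?thesis using t by (simp add: field_simps)
    qed
    ultimately have "sublinear u" by (simp add: sublinear_def)
    moreover obtain q where "q \<in> C" using False by blast
    then have "u x \<le> q0 x" for x using le[of q x] CA[of q] unfolding A_def by (auto intro: order.trans)
    ultimately have "u \<in> A" by (simp add: A_def)
    then show ?thesis using le unfolding P_def by blast
  qed
  ultimately obtain m where m: "m \<in> A" "\<And>q. q \<in> A \<Longrightarrow> P m q \<Longrightarrow> q = m"
    using predicate_Zorn[of A P] by blast
  have sub: "sublinear m" and m_le: "\<And>x. m x \<le> q0 x" using m(1) by (auto simp: A_def)
  have neg: "m (- a) = - m a" for a
  proof -
    obtain r where r: "sublinear r" "\<And>x. r x \<le> m x" "r (- a) \<le> - m a"
      using sublinear_improve[OF sub order.refl] by blast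
    then have "r \<in> A" using m_le by (auto simp: A_def intro: order.trans)
    then have "r = m" using m(2) r(2) by (simp add: P_def)
    then show ?thesis using r(3) sublinear_minus[OF sub, of a] by simp
  qed
  have "linear m"
  proof (rule linearI)
    fix x y :: 'a and c :: real
    show "m (x + y) = m x + m y"
      using sublinear_add[OF sub, of x y] sublinear_add[OF sub, of "x + y" "- y"] neg[of y] by simp
    show "m (c *\<^sub>R x) = c *\<^sub>R m x"
    proof (cases "c \<ge> 0")
      case False
      then show ?thesis using sublinear_scaleR[OF sub, of "- c" x] neg[of "c *\<^sub>R x"] by simp
    qed (simp add: sublinear_scaleR[OF sub])
  qed
  then show ?thesis using m_le that by blast
qed

text \<open>Lowering the norm at \<open>- w\<close> to \<open>- norm w\<close> before taking a
  linear minorant forces the value at \<open>w\<close> to be at least, hence exactly,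
  \<open>norm w\<close>.\<close>

lemma norming_functional:
  fixes w :: "'a::real_normed_vector"
  obtains \<psi> :: "'a \<Rightarrow>\<^sub>L real" where "norm \<psi> \<le> 1" "blinfun_apply \<psi> w = norm w"
proof -
  obtain r where r: "sublinear r" "\<And>x. r x \<le> norm x" "r (- w) \<le> - norm w"
    using sublinear_improve[OF sublinear_norm order.refl] by blast
  obtain l where l: "linear l" "\<And>x. l x \<le> r x"
    using sublinear_dominates_linear[OF r(1)] by blast
  have le: "l x \<le> norm x" for x using l(2) r(2) by (rule order.trans)
  have bound: "norm (l x) \<le> norm x * 1" for x
    using le[of x] le[of "- x"] linear_neg[OF l(1), of x] by (simp add: abs_le_iff)
  have bl: "bounded_linear l"
    by (rule bounded_linear_intro[of l 1])
       (use l(1) bound in \<open>auto simp: linear_add linear_scale\<close>)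
  show ?thesis
  proof (rule that[of "Blinfun l"])
    show "norm (Blinfun l) \<le> 1"
      by (rule norm_blinfun_bound) (use bound in \<open>auto simp: bounded_linear_Blinfun_apply[OF bl]\<close>)
    show "blinfun_apply (Blinfun l) w = norm w"
      using l(2)[of "- w"] r(3) le[of w] linear_neg[OF l(1), of w]
      by (simp add: bounded_linear_Blinfun_apply[OF bl])
  qed
qed

section \<open>Boundedness and examples of weakly p-summable sequences\<close>

text \<open>Uniform boundedness for the \<open>x n\<close> as functionals on the dual space, which
  is complete: by Baire some closed set \<open>T m\<close> contains a ball, and moving from its
  centre along a norming functional of \<open>x n\<close> bounds \<open>norm (x n)\<close>.\<close>

lemma weakly_bounded_imp_bounded:
  fixes x :: "nat \<Rightarrow> 'a::real_normed_vector"
  assumes "\<And>\<phi> :: 'a \<Rightarrow>\<^sub>L real. bounded (range (\<lambda>n. blinfun_apply \<phi> (x n)))"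
  shows "bounded (range x)"
proof -
  define T where "T m = {\<phi> :: 'a \<Rightarrow>\<^sub>L real. \<forall>n. \<bar>blinfun_apply \<phi> (x n)\<bar> \<le> real m}" for m
  have closed: "closed (T m)" for m
    unfolding T_def by (intro closed_Collect_all closed_Collect_le continuous_intros)
  have cover: "(\<Union>m. T m) = UNIV"
  proof -
    have "\<exists>m. \<phi> \<in> T m" for \<phi>
    proof -
      obtain c where c: "\<And>n. \<bar>blinfun_apply \<phi> (x n)\<bar> \<le> c"
        using assms[of \<phi>] by (auto simp: bounded_iff)
      obtain m :: nat where "c \<le> real m" using real_arch_simple by blast
      then have "\<phi> \<in> T m" by (auto simp: T_def intro: order.trans[OF c])
      then show ?thesis ..
    qed
    then show ?thesis by blast
  qed
  have "\<exists>m. interior (T m) \<noteq> {}"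
  proof (rule ccontr)
    assume "\<not> ?thesis"
    then have "euclidean interior_of \<Union> (range T) = {}"
      by (intro Baire_category_alt) (use closed in \<open>auto simp: completely_metrizable_space_euclidean\<close>)
    then show False using cover by simp
  qed
  then obtain m \<phi>0 e where e: "e > 0" "cball \<phi>0 e \<subseteq> T m"
    by (metis mem_interior_cball ex_in_conv)
  have "norm (x n) \<le> 2 * real m / e" for n
  proof -
    obtain \<psi> :: "'a \<Rightarrow>\<^sub>L real" where \<psi>: "norm \<psi> \<le> 1" "blinfun_apply \<psi> (x n) = norm (x n)"
      using norming_functional by blast
    have "\<phi>0 + e *\<^sub>R \<psi> \<in> cball \<phi>0 e" "\<phi>0 \<in> cball \<phi>0 e"
      using e(1) \<psi>(1) by (auto simp: dist_norm mult_left_le)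
    then have "\<phi>0 + e *\<^sub>R \<psi> \<in> T m" "\<phi>0 \<in> T m" using e(2) by auto
    then have "\<bar>blinfun_apply \<phi>0 (x n) + e * norm (x n)\<bar> \<le> real m" "\<bar>blinfun_apply \<phi>0 (x n)\<bar> \<le> real m"
      unfolding T_def by (auto simp: blinfun.add_left blinfun.scaleR_left \<psi>(2) dest: spec[of _ n])
    then have "e * norm (x n) \<le> 2 * real m" by linarith
    then show ?thesis using e(1) by (simp add: field_simps)
  qed
  then show ?thesis by (auto simp: bounded_iff)
qed

lemma weakly_p_summable_imp_bounded:
  assumes "1 \<le> p" "weakly_p_summable p x"
  shows "bounded (range x)"
proof (rule weakly_bounded_imp_bounded)
  fix \<phi> :: "'a \<Rightarrow>\<^sub>L real"
  show "bounded (range (\<lambda>n. blinfun_apply \<phi> (x n)))"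
  proof (cases "p = \<infinity>")
    case True
    then show ?thesis
      using assms convergent_imp_bounded by (auto simp: weakly_p_summable_def)
  next
    case False
    then have r: "1 \<le> real_of_ereal p" using assms(1) by (cases p) auto
    have "summable (\<lambda>n. \<bar>blinfun_apply \<phi> (x n)\<bar> powr real_of_ereal p)"
      using assms(2) False by (simp add: weakly_p_summable_def)
    then have "bounded (range (\<lambda>n. \<bar>blinfun_apply \<phi> (x n)\<bar> powr real_of_ereal p))"
      by (rule convergent_imp_bounded[OF summable_LIMSEQ_zero])
    then obtain M where M: "\<And>n. \<bar>blinfun_apply \<phi> (x n)\<bar> powr real_of_ereal p \<le> M"
      by (auto simp: bounded_iff)
    \<comment> \<open>Values above 1 are at most their own p-th power, as p is at least 1.\<close>
    have "\<bar>blinfun_apply \<phi> (x n)\<bar> \<le> max 1 M" for n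
    proof (cases "\<bar>blinfun_apply \<phi> (x n)\<bar> \<le> 1")
      case False
      then have "\<bar>blinfun_apply \<phi> (x n)\<bar> powr 1 \<le> \<bar>blinfun_apply \<phi> (x n)\<bar> powr real_of_ereal p"
        using r by (intro powr_mono) auto
      then show ?thesis using M[of n] by simp
    qed simp
    then show ?thesis by (auto simp: bounded_iff)
  qed
qed

text \<open>Supplies the test sequences by which uniformly p-convergent sets are shown to be
  bounded.\<close>

lemma weakly_p_summable_if_geometric:
  assumes "1 \<le> p" "\<And>n. norm (x n) \<le> (1/2) ^ n"
  shows "weakly_p_summable p x"
proof -
  have le: "\<bar>blinfun_apply \<phi> (x n)\<bar> \<le> norm \<phi> * (1/2) ^ n" for \<phi> :: "'a \<Rightarrow>\<^sub>L real" and n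
    using norm_blinfun[of \<phi> "x n"] mult_left_mono[OF assms(2)[of n] norm_ge_zero[of \<phi>]] by simp
  show ?thesis
  proof (cases "p = \<infinity>")
    case True
    have "(\<lambda>n. norm \<phi> * (1/2) ^ n) \<longlonglongrightarrow> 0" for \<phi> :: "'a \<Rightarrow>\<^sub>L real"
      using LIMSEQ_power_zero[of "1/2 :: real"] by (intro tendsto_mult_right_zero) simp
    then have "(\<lambda>n. blinfun_apply \<phi> (x n)) \<longlonglongrightarrow> 0" for \<phi> :: "'a \<Rightarrow>\<^sub>L real"
      by (rule Lim_null_comparison[where g = "\<lambda>n. norm \<phi> * (1/2) ^ n", rotated])
         (simp add: le)
    then show ?thesis by (simp add: weakly_p_summable_def True)
  next
    case False
    define r where "r = real_of_ereal p"
    have r: "1 \<le> r" using assms(1) False unfolding r_def by (cases p) auto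
    have "summable (\<lambda>n. \<bar>blinfun_apply \<phi> (x n)\<bar> powr r)" for \<phi> :: "'a \<Rightarrow>\<^sub>L real"
    proof (rule summable_comparison_test')
      have "(1/2 :: real) powr r < 1" using r powr_less_mono'[of "1/2" 0 r] by simp
      then show "summable (\<lambda>n. norm \<phi> powr r * ((1/2) powr r) ^ n)"
        by (intro summable_mult summable_geometric) simp
      fix n
      have "((1/2 :: real) ^ n) powr r = ((1/2) powr r) ^ n"
        by (simp add: powr_realpow[symmetric] powr_powr mult.commute)
      then show "norm (\<bar>blinfun_apply \<phi> (x n)\<bar> powr r) \<le> norm \<phi> powr r * ((1/2) powr r) ^ n"
        using powr_mono2[OF _ _ le, of r \<phi> n] r by (simp add: powr_mult)
    qed
    then show ?thesis using False by (simp add: weakly_p_summable_def r_def)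
  qed
qed

section \<open>The exhaustion of an open convex set\<close>

text \<open>The ball condition expresses the distance to the complement and stays meaningful if that
  is empty. The summand 1 keeps the radius positive at \<open>n = 0\<close>, so that the members lie
  in \<open>U\<close> as centres of such balls.\<close>

definition exhaustion :: "'a::real_normed_vector set \<Rightarrow> nat \<Rightarrow> 'a set" where
  "exhaustion U n = {x. norm x \<le> real n \<and> ball x (1 / (real n + 1)) \<subseteq> U}"

lemma exhaustion_subset: "exhaustion U n \<subseteq> U"
  by (auto simp: exhaustion_def)

lemma exhaustion_mono: "m \<le> n \<Longrightarrow> exhaustion U m \<subseteq> exhaustion U n"
  unfolding exhaustion_def using subset_ball[of "1 / (real n + 1)" "1 / (real m + 1)"]
  by (force simp: frac_le)

lemma U_bounded_mono: "U_bounded U B \<Longrightarrow> A \<subseteq> B \<Longrightarrow> U_bounded U A"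
  unfolding U_bounded_def bounded_off_boundary_def
  by (metis bounded_subset less_le_trans setdist_subset_left subset_empty subset_trans)

lemma bounded_off_boundaryI:
  assumes "bounded B" "0 < r" "\<And>x y. x \<in> B \<Longrightarrow> y \<in> frontier U \<Longrightarrow> r \<le> dist x y"
  shows "bounded_off_boundary U B"
  unfolding bounded_off_boundary_def using assms le_setdistI[of B "frontier U" r] by force

lemma dist_frontier_ge:
  assumes "open U" "ball x r \<subseteq> U" "y \<in> frontier U"
  shows "r \<le> dist x y"
proof -
  have "y \<notin> U" using assms by (simp add: frontier_def interior_open)
  then show ?thesis using assms(2) by (meson linorder_not_le mem_ball subsetD)
qed

lemma U_bounded_exhaustion: "open U \<Longrightarrow> U_bounded U (exhaustion U n)"
  unfolding U_bounded_def
  by (intro conjI exhaustion_subset bounded_off_boundaryI[where r = "1 / (real n + 1)"])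
     (auto simp: exhaustion_def bounded_iff intro: dist_frontier_ge)

text \<open>If \<open>r\<close> bounds the distance to the frontier from below, balls of radius
  \<open>r\<close> around points of \<open>B\<close> stay in \<open>U\<close>: being connected, they
  cannot leave it without meeting the frontier. Estimates on U-bounded sets thus reduce to the
  exhaustion.\<close>

lemma U_bounded_subset_exhaustion:
  assumes B: "U_bounded U B"
  obtains n where "B \<subseteq> exhaustion U n"
proof -
  have BU: "B \<subseteq> U" using B by (simp add: U_bounded_def)
  obtain M where M: "\<And>x. x \<in> B \<Longrightarrow> norm x \<le> M"
    using B by (auto simp: U_bounded_def bounded_off_boundary_def bounded_iff)
  obtain r where r: "r > 0" "\<And>x y. x \<in> B \<Longrightarrow> y \<in> frontier U \<Longrightarrow> r \<le> dist x y"
    using B setdist_le_dist[of _ B _ "frontier U"] unfolding U_bounded_def bounded_off_boundary_def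
    by (metis empty_iff zero_less_one)
  have ball: "ball x r \<subseteq> U" if "x \<in> B" for x
  proof (rule ccontr)
    assume "\<not> ball x r \<subseteq> U"
    then have "ball x r \<inter> frontier U \<noteq> {}"
      using that BU r(1) by (intro connected_Int_frontier) (auto intro: centre_in_ball[THEN iffD2])
    then show False using r(2)[OF that] by fastforce
  qed
  obtain n :: nat where n: "max M (1 / r) \<le> real n" using real_arch_simple by blast
  have "1 / (real n + 1) \<le> r" using n r(1) by (simp add: field_simps)
  then have "B \<subseteq> exhaustion U n"
    using M n ball subset_ball by (fastforce simp: exhaustion_def)
  then show ?thesis by (rule that)
qed

lemma exhaustion_UN:
  assumes "open U" "x \<in> U" obtains n where "x \<in> exhaustion U n"
proof -
  obtain r where r: "r > 0" "ball x r \<subseteq> U" using assms by (meson open_contains_ball)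
  have "U_bounded U {x}"
    unfolding U_bounded_def using assms(2) r(1) dist_frontier_ge[OF assms(1) r(2)]
    by (auto intro!: bounded_off_boundaryI[where r = r])
  then show ?thesis using that by (rule U_bounded_subset_exhaustion) auto
qed

text \<open>A point near the convex combination is displaced from it by some \<open>w\<close>; the
  two end points displaced by the same \<open>w\<close> stay in \<open>U\<close>.\<close>

lemma convex_exhaustion:
  fixes U :: "'a::real_normed_vector set"
  assumes U: "convex U"
  shows "convex (exhaustion U n)"
proof (rule convexI)
  fix x y :: 'a and u v :: real
  assume xy: "x \<in> exhaustion U n" "y \<in> exhaustion U n" and uv: "0 \<le> u" "0 \<le> v" "u + v = 1"
  have "norm (u *\<^sub>R x + v *\<^sub>R y) \<le> u * norm x + v * norm y"
    using uv norm_triangle_ineq[of "u *\<^sub>R x" "v *\<^sub>R y"] by simp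
  also have "\<dots> \<le> real n"
    using xy uv by (intro convex_bound_le) (auto simp: exhaustion_def)
  finally have "norm (u *\<^sub>R x + v *\<^sub>R y) \<le> real n" .
  moreover have "z \<in> U" if z: "z \<in> ball (u *\<^sub>R x + v *\<^sub>R y) (1 / (real n + 1))" for z
  proof -
    define w where "w = z - (u *\<^sub>R x + v *\<^sub>R y)"
    have w: "norm w < 1 / (real n + 1)" using z by (simp add: w_def dist_norm norm_minus_commute)
    have "x + w \<in> U" "y + w \<in> U"
      using xy w by (auto simp: exhaustion_def dist_norm subset_iff)
    then have "u *\<^sub>R (x + w) + v *\<^sub>R (y + w) \<in> U"
      using U uv by (intro convexD)
    moreover have "u *\<^sub>R (x + w) + v *\<^sub>R (y + w) = u *\<^sub>R x + v *\<^sub>R y + (u + v) *\<^sub>R w"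
      by (simp add: algebra_simps)
    ultimately show ?thesis using uv(3) by (simp add: w_def)
  qed
  ultimately show "u *\<^sub>R x + v *\<^sub>R y \<in> exhaustion U n" by (auto simp: exhaustion_def)
qed

lemma exhaustion_subset_interior: "exhaustion U n \<subseteq> interior (exhaustion U (2 * n + 2))"
proof
  fix x assume x: "x \<in> exhaustion U n"
  \<comment> \<open>The index \<open>2 * n + 2\<close> makes \<open>r\<close> at most half of the
    radius at level \<open>n\<close>, which leaves room for a second ball of radius
    \<open>r\<close>.\<close>
  define r where "r = 1 / (real (2 * n + 2) + 1)"
  have r: "0 < r" "r \<le> 1" "2 * r \<le> 1 / (real n + 1)" by (auto simp: r_def field_simps)
  have "ball x r \<subseteq> exhaustion U (2 * n + 2)"
  proof
    fix y assume y: "y \<in> ball x r"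
    have "ball y r \<subseteq> ball x (1 / (real n + 1))"
    proof
      fix z assume "z \<in> ball y r"
      then show "z \<in> ball x (1 / (real n + 1))"
        using y r(3) dist_triangle[of x z y] by simp
    qed
    moreover have "norm y \<le> norm x + dist x y" using norm_triangle_sub[of y x] by (simp add: dist_norm norm_minus_commute)
    ultimately show "y \<in> exhaustion U (2 * n + 2)"
      using x y r(2) unfolding exhaustion_def mem_Collect_eq r_def[symmetric] by auto
  qed
  then show "x \<in> interior (exhaustion U (2 * n + 2))" using r(1) by (meson mem_interior)
qed

text \<open>A vector \<open>h\<close> close to the boundary of \<open>U\<close> is close to a point of \<open>U\<close>, so it is pushed well
  inside \<open>U\<close> by mixing in a fixed interior point \<open>u\<close>.\<close>

lemma directions_off_boundary:
  fixes U :: "'a::real_normed_vector set"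
  assumes U: "open U" "convex U" "u \<in> U" and \<delta>: "0 < \<delta>"
  obtains B K where "bounded_off_boundary U B"
    "\<And>h. norm h \<le> 1 \<Longrightarrow> \<exists>c. \<exists>b\<in>B. \<bar>c\<bar> \<le> K \<and> norm (h - c *\<^sub>R b) \<le> \<delta>"
proof -
  obtain r where r: "r > 0" "ball u r \<subseteq> U" using U by (meson open_contains_ball)
  \<comment> \<open>The share of \<open>u\<close> that is mixed into \<open>h\<close>, at the cost
    of an error \<open>d * norm u\<close>.\<close>
  define d where "d = min 1 (\<delta> / (1 + norm u))"
  have d: "0 < d" "d \<le> 1" "d * norm u \<le> \<delta>"
  proof -
    show "0 < d" "d \<le> 1" using \<delta> by (auto simp: d_def add_pos_nonneg)
    have "d * norm u \<le> \<delta> / (1 + norm u) * (1 + norm u)"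
      using \<delta> by (intro mult_mono) (auto simp: d_def)
    also have "\<dots> = \<delta>" by (simp add: add_pos_nonneg less_imp_neq[THEN not_sym])
    finally show "d * norm u \<le> \<delta>" .
  qed
  \<comment> \<open>The divisor 3 comes from the bound \<open>2 * s + s\<close> for
    \<open>d * norm (u' - u)\<close> below.\<close>
  define s where "s = r * d / 3"
  have s: "0 < s" using r d by (simp add: s_def)
  define B where "B = {b. norm b \<le> 1 + norm u \<and> (\<forall>y\<in>frontier U. s \<le> dist b y)}"
  have "bounded_off_boundary U B"
    using s by (intro bounded_off_boundaryI[of _ s]) (auto simp: B_def bounded_iff)
  moreover have "\<exists>c. \<exists>b\<in>B. \<bar>c\<bar> \<le> 2 \<and> norm (h - c *\<^sub>R b) \<le> \<delta>" if h: "norm h \<le> 1" for h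
  proof (cases "h \<in> B")
    case True
    then show ?thesis using \<delta> by (intro exI[of _ 1] bexI[of _ h]) auto
  next
    case False
    moreover have "norm h \<le> 1 + norm u" using h by (simp add: add_increasing2)
    ultimately obtain y where y: "y \<in> frontier U" "dist h y < s"
      by (auto simp: B_def not_le)
    then have "y \<in> closure U" by (simp add: frontier_def)
    then obtain y' where y': "y' \<in> U" "dist y' y < s - dist h y"
      using y(2) unfolding closure_approachable by (meson diff_gt_0_iff_gt)
    have hy': "norm (h - y') < s"
      using y'(2) dist_triangle2[of h y' y] by (simp add: dist_norm)
    define b where "b = (1 / (1 + d)) *\<^sub>R (h + d *\<^sub>R u)"
    have b: "(1 + d) *\<^sub>R b = h + d *\<^sub>R u" using d by (simp add: b_def)
    have "ball b s \<subseteq> U"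
    proof
      fix z assume z: "z \<in> ball b s"
      \<comment> \<open>Chosen so that \<open>z\<close> is a convex combination of \<open>y'\<close>
        and \<open>u'\<close>; it remains to see that \<open>u'\<close> is within \<open>r\<close>
        of \<open>u\<close>.\<close>
      define u' where "u' = (1 / d) *\<^sub>R ((1 + d) *\<^sub>R z - y')"
      have du': "d *\<^sub>R u' = (1 + d) *\<^sub>R z - y'" using d by (simp add: u'_def)
      have "d *\<^sub>R (u' - u) = (1 + d) *\<^sub>R (z - b) + (h - y')"
        using b by (simp add: scaleR_diff_right du' algebra_simps)
      then have "d * norm (u' - u) \<le> (1 + d) * norm (z - b) + norm (h - y')"
        using d norm_triangle_ineq[of "(1 + d) *\<^sub>R (z - b)" "h - y'"] norm_scaleR[of d "u' - u"] by simp
      also have "\<dots> < 2 * s + s"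
      proof (rule add_le_less_mono)
        show "(1 + d) * norm (z - b) \<le> 2 * s"
          using z d by (intro mult_mono) (auto simp: dist_norm norm_minus_commute)
      qed (rule hy')
      finally have "norm (u' - u) < r" using d by (simp add: s_def mult.commute)
      then have "u' \<in> U" using r by (auto simp: dist_norm norm_minus_commute subset_iff)
      then have "(1 / (1 + d)) *\<^sub>R y' + (d / (1 + d)) *\<^sub>R u' \<in> U"
        using U y' d by (intro convexD) (auto simp: field_simps)
      moreover have "(1 / (1 + d)) *\<^sub>R y' + (d / (1 + d)) *\<^sub>R u' = (1 / (1 + d)) *\<^sub>R (y' + d *\<^sub>R u')"
        by (simp add: scaleR_add_right)
      moreover have "\<dots> = z" using d by (simp add: du')
      ultimately show "z \<in> U" by simp
    qed
    moreover have "norm b \<le> 1 + norm u"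
    proof -
      have "norm b \<le> norm (h + d *\<^sub>R u)" using d by (simp add: b_def divide_le_eq distrib_left del: scaleR_add_right)
      also have "\<dots> \<le> norm h + d * norm u" using d norm_triangle_ineq[of h "d *\<^sub>R u"] by simp
      also have "\<dots> \<le> 1 + 1 * norm u" using h d by (intro add_mono mult_right_mono) auto
      finally show ?thesis by simp
    qed
    ultimately have "b \<in> B" using dist_frontier_ge[OF U(1)] by (auto simp: B_def)
    moreover have "norm (h - (1 + d) *\<^sub>R b) \<le> \<delta>" using d by (simp add: b)
    ultimately show ?thesis using d by (intro exI[of _ "1 + d"] bexI[of _ b]) auto
  qed
  ultimately show ?thesis by (rule that)
qed

text \<open>A small ball around 0 is U-bounded and contains a nonzero multiple of every vector, so
  directions are reached exactly.\<close>

lemma directions_U_bounded_zero: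
  fixes U :: "'a::real_normed_vector set"
  assumes U: "open U" "0 \<in> U"
  obtains B K where "U_bounded U B"
    "\<And>h. norm h \<le> 1 \<Longrightarrow> \<exists>c. \<exists>b\<in>B. \<bar>c\<bar> \<le> K \<and> norm (h - c *\<^sub>R b) = 0"
proof -
  obtain n where n: "0 \<in> exhaustion U n" using exhaustion_UN[OF U] by blast
  then obtain r where r: "r > 0" "cball 0 r \<subseteq> exhaustion U (2 * n + 2)"
    using exhaustion_subset_interior[of U n] by (meson mem_interior_cball subsetD)
  show ?thesis
  proof (rule that[of "cball 0 r" "1 / r"])
    show "U_bounded U (cball 0 r)" using U_bounded_mono[OF U_bounded_exhaustion[OF U(1)] r(2)] .
    fix h :: 'a assume "norm h \<le> 1"
    then show "\<exists>c. \<exists>b\<in>cball 0 r. \<bar>c\<bar> \<le> 1 / r \<and> norm (h - c *\<^sub>R b) = 0"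
      using r(1) by (intro exI[of _ "1 / r"] bexI[of _ "r *\<^sub>R h"]) (auto simp: mult_left_le)
  qed
qed

section \<open>Functions differentiable in the directions of an open cone\<close>

lemma DERIV_nonpos_if_right_max:
  fixes \<xi> :: "real \<Rightarrow> real"
  assumes "(\<xi> has_real_derivative l) (at 0)" "0 < d" "\<And>\<tau>. 0 < \<tau> \<Longrightarrow> \<tau> < d \<Longrightarrow> \<xi> \<tau> \<le> \<xi> 0"
  shows "l \<le> 0"
proof (rule ccontr)
  assume "\<not> l \<le> 0"
  then obtain e where e: "e > 0" "\<And>h. 0 < h \<Longrightarrow> h < e \<Longrightarrow> \<xi> 0 < \<xi> h"
    using has_real_derivative_pos_inc_right[OF assms(1)] by force
  then show False
    using assms(3)[of "min d e / 2"] e(2)[of "min d e / 2"] assms(2) by linarith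
qed

text \<open>The model for \<open>\<phi>\<close> is a functional applied to \<open>f\<close>:
  derivatives are known only along a ball of directions around \<open>u\<close>, hence along the
  cone that it spans. The Lipschitz constant is absorbed in \<open>S\<close>.\<close>

locale cone_differentiable =
  fixes V :: "'a::real_normed_vector set" and u :: 'a and r :: real
    and \<phi> :: "'a \<Rightarrow> real" and L :: "'a \<Rightarrow> 'a \<Rightarrow> real" and S :: "'a \<Rightarrow>\<^sub>L 'z::real_normed_vector"
  assumes V: "open V" "convex V" and r: "0 < r"
    and linear: "x \<in> V \<Longrightarrow> linear (L x)"
    and bound: "x \<in> V \<Longrightarrow> \<bar>L x h\<bar> \<le> norm (blinfun_apply S h)"
    and deriv: "x \<in> V \<Longrightarrow> b \<in> ball u r \<Longrightarrow> ((\<lambda>t. \<phi> (x + t *\<^sub>R b)) has_real_derivative L x b) (at 0)"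
begin

text \<open>The vector \<open>\<alpha> *\<^sub>R u + h\<close> is \<open>\<alpha>\<close> times a
  point of \<open>ball u r\<close>, so the chain rule applies; a factor \<open>c\<close> of either
  sign allows moving backwards.\<close>

lemma deriv_cone:
  assumes x: "x \<in> V" and \<alpha>: "0 < \<alpha>" "norm h < \<alpha> * r"
  shows "((\<lambda>t. \<phi> (x + t *\<^sub>R c *\<^sub>R (\<alpha> *\<^sub>R u + h))) has_real_derivative c * L x (\<alpha> *\<^sub>R u + h)) (at 0)"
proof -
  define b where "b = u + (1 / \<alpha>) *\<^sub>R h"
  have \<alpha>b: "\<alpha> *\<^sub>R b = \<alpha> *\<^sub>R u + h" using \<alpha> by (simp add: b_def scaleR_add_right)
  have "b \<in> ball u r" using \<alpha> by (simp add: b_def dist_norm field_simps)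
  then have "((\<lambda>t. \<phi> (x + t *\<^sub>R b)) has_real_derivative L x b) (at (c * \<alpha> * 0))"
    using deriv[OF x] by simp
  then have "((\<lambda>t. \<phi> (x + (c * \<alpha> * t) *\<^sub>R b)) has_real_derivative L x b * (c * \<alpha>)) (at 0)"
    by (rule DERIV_chain2) (auto intro!: derivative_eq_intros)
  moreover have "c * L x (\<alpha> *\<^sub>R u + h) = L x b * (c * \<alpha>)"
    by (simp add: \<alpha>b[symmetric] linear_scale[OF linear[OF x]])
  moreover have "(\<lambda>t. \<phi> (x + (c * \<alpha> * t) *\<^sub>R b)) = (\<lambda>t. \<phi> (x + t *\<^sub>R c *\<^sub>R (\<alpha> *\<^sub>R u + h)))"
    by (simp add: \<alpha>b[symmetric] mult_ac)
  ultimately show ?thesis by metis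
qed

text \<open>Along a direction of the cone the usual mean value estimate applies, over the interval
  \<open>J\<close> of parameters that stay in \<open>V\<close>.\<close>

lemma lipschitz_cone:
  assumes w: "w \<in> V" "w + s *\<^sub>R k \<in> V" and k: "k = \<alpha> *\<^sub>R u + h" "0 < \<alpha>" "norm h < \<alpha> * r"
  shows "\<bar>\<phi> (w + s *\<^sub>R k) - \<phi> w\<bar> \<le> \<bar>s\<bar> * norm (blinfun_apply S k)"
proof -
  define J where "J = {t. w + t *\<^sub>R k \<in> V}"
  have "convex J"
  proof (rule convexI)
    fix a b \<mu> \<nu> :: real
    assume "a \<in> J" "b \<in> J" and \<mu>\<nu>: "0 \<le> \<mu>" "0 \<le> \<nu>" "\<mu> + \<nu> = 1"
    then have "\<mu> *\<^sub>R (w + a *\<^sub>R k) + \<nu> *\<^sub>R (w + b *\<^sub>R k) \<in> V"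
      using V(2) by (intro convexD) (auto simp: J_def)
    moreover have "\<mu> *\<^sub>R (w + a *\<^sub>R k) + \<nu> *\<^sub>R (w + b *\<^sub>R k) = (\<mu> + \<nu>) *\<^sub>R w + (\<mu> * a + \<nu> * b) *\<^sub>R k"
      by (simp add: algebra_simps)
    ultimately show "\<mu> *\<^sub>R a + \<nu> *\<^sub>R b \<in> J" using \<mu>\<nu> by (simp add: J_def)
  qed
  moreover have "((\<lambda>t. \<phi> (w + t *\<^sub>R k)) has_real_derivative L (w + t *\<^sub>R k) k) (at t within J)" if "t \<in> J" for t
  proof -
    have "((\<lambda>s. \<phi> (w + (s + t) *\<^sub>R k)) has_real_derivative L (w + t *\<^sub>R k) k) (at 0)"
      using deriv_cone[of "w + t *\<^sub>R k" \<alpha> h 1] that k by (simp add: J_def algebra_simps)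
    then show ?thesis
      using DERIV_shift[of "\<lambda>t. \<phi> (w + t *\<^sub>R k)" _ 0 t] has_field_derivative_at_within by fastforce
  qed
  moreover have "norm (L (w + t *\<^sub>R k) k) \<le> norm (blinfun_apply S k)" if "t \<in> J" for t
    using bound that by (simp add: J_def)
  ultimately have "norm (\<phi> (w + s *\<^sub>R k) - \<phi> (w + 0 *\<^sub>R k)) \<le> norm (blinfun_apply S k) * norm (s - 0)"
    by (rule field_differentiable_bound) (use w in \<open>auto simp: J_def\<close>)
  then show ?thesis by (simp add: mult.commute)
qed

text \<open>A small displacement \<open>h\<close> is the difference of the cone directions
  \<open>\<alpha> *\<^sub>R u + h\<close> and \<open>\<alpha> *\<^sub>R u\<close>, with
  \<open>\<alpha>\<close> proportional to \<open>norm h\<close>; \<open>lipschitz_cone\<close>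
  bounds both legs. Continuity yields the maximum used in \<open>increment_le\<close>.\<close>

lemma continuous_on: "continuous_on V \<phi>"
proof -
  have "isCont \<phi> w" if w: "w \<in> V" for w
  proof -
    obtain \<rho> where \<rho>: "\<rho> > 0" "ball w \<rho> \<subseteq> V" using V(1) w by (meson open_contains_ball)
    have inV: "w + h \<in> V" if "norm h < \<rho>" for h
      using \<rho>(2)[THEN subsetD, of "w + h"] that by (simp add: dist_norm)
    define M where "M = 2 / r * (norm S * (r + 2 * norm u))"
    define d where "d = \<rho> / (1 + 2 / r * norm u)"
    have pos: "1 + 2 / r * norm u > 0" using r by (simp add: add_pos_nonneg)
    have "\<bar>\<phi> (w + h) - \<phi> w\<bar> \<le> M * norm h" if h: "norm h < d" for h
    proof (cases "h = 0")
      case False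
      define \<alpha> where "\<alpha> = 2 / r * norm h"
      have \<alpha>: "0 < \<alpha>" "norm h < \<alpha> * r" using r False by (auto simp: \<alpha>_def)
      have *: "norm h + \<alpha> * norm u < \<rho>"
      proof -
        have "norm h + \<alpha> * norm u = norm h * (1 + 2 / r * norm u)" by (simp add: \<alpha>_def algebra_simps)
        also have "\<dots> < \<rho>" using h pos by (simp add: d_def pos_less_divide_eq)
        finally show ?thesis .
      qed
      have "norm h < \<rho>" using * mult_nonneg_nonneg[OF less_imp_le[OF \<alpha>(1)] norm_ge_zero[of u]] by linarith
      then have in1: "w + h \<in> V" by (rule inV)
      have in2: "w + h + \<alpha> *\<^sub>R u \<in> V"
      proof -
        have "norm (h + \<alpha> *\<^sub>R u) < \<rho>"
          using * \<alpha>(1) norm_triangle_ineq[of h "\<alpha> *\<^sub>R u"] by simp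
        then have "w + (h + \<alpha> *\<^sub>R u) \<in> V"
          by (rule inV)
        then show ?thesis by (simp add: add_ac)
      qed
      have "\<bar>\<phi> (w + 1 *\<^sub>R (\<alpha> *\<^sub>R u + h)) - \<phi> w\<bar> \<le> \<bar>1\<bar> * norm (blinfun_apply S (\<alpha> *\<^sub>R u + h))"
        by (rule lipschitz_cone[OF w _ refl \<alpha>]) (use in2 in \<open>simp add: add_ac\<close>)
      also have "\<dots> \<le> norm S * (norm h + \<alpha> * norm u)"
      proof -
        have "norm (\<alpha> *\<^sub>R u + h) \<le> norm h + \<alpha> * norm u"
          using norm_triangle_ineq[of "\<alpha> *\<^sub>R u" h] \<alpha>(1) by simp
        then have "norm S * norm (\<alpha> *\<^sub>R u + h) \<le> norm S * (norm h + \<alpha> * norm u)"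
          by (rule mult_left_mono) simp
        then show ?thesis using norm_blinfun[of S "\<alpha> *\<^sub>R u + h"] by simp
      qed
      finally have 1: "\<bar>\<phi> (w + h + \<alpha> *\<^sub>R u) - \<phi> w\<bar> \<le> norm S * (norm h + \<alpha> * norm u)"
        by (simp add: add_ac)
      have "\<bar>\<phi> (w + h + 1 *\<^sub>R (\<alpha> *\<^sub>R u)) - \<phi> (w + h)\<bar> \<le> \<bar>1\<bar> * norm (blinfun_apply S (\<alpha> *\<^sub>R u))"
        by (rule lipschitz_cone[OF in1, where h = 0 and \<alpha> = \<alpha>]) (use in2 \<alpha>(1) r in auto)
      also have "\<dots> \<le> norm S * (\<alpha> * norm u)"
        using norm_blinfun[of S "\<alpha> *\<^sub>R u"] \<alpha>(1) by simp
      finally have 2: "\<bar>\<phi> (w + h + \<alpha> *\<^sub>R u) - \<phi> (w + h)\<bar> \<le> norm S * (\<alpha> * norm u)" by simp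
      have "norm S * (norm h + \<alpha> * norm u) + norm S * (\<alpha> * norm u) \<le> M * norm h"
      proof -
        have "M * norm h = norm S * (2 * norm h + 4 / r * norm h * norm u)"
          using r by (simp add: M_def field_simps)
        also have "\<dots> = norm S * (norm h + \<alpha> * norm u) + norm S * (\<alpha> * norm u) + norm S * norm h"
          by (simp add: \<alpha>_def algebra_simps)
        finally show ?thesis by simp
      qed
      then show ?thesis using 1 2 by linarith
    qed simp
    moreover have "0 < d" using \<rho>(1) pos by (simp add: d_def)
    ultimately have ev: "\<forall>\<^sub>F h in at 0. norm (\<phi> (w + h) - \<phi> w) \<le> M * norm h"
      by (auto simp: eventually_at)
    have "((\<lambda>h. M * norm h) \<longlongrightarrow> 0) (at (0 :: 'a))"
      by (auto intro!: tendsto_eq_intros)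
    then have "((\<lambda>h. \<phi> (w + h) - \<phi> w) \<longlongrightarrow> 0) (at 0)"
      by (rule Lim_null_comparison[OF ev])
    then show ?thesis by (simp add: isCont_iff LIM_zero_iff)
  qed
  then show ?thesis by (simp add: continuous_at_imp_continuous_on)
qed

text \<open>Since \<open>\<phi>\<close> is differentiable only in the directions of an open cone, the mean value theorem
  does not apply to the segment from \<open>x\<close> to \<open>y\<close>. Write \<open>y - x = k1 - k2\<close> with \<open>k1, k2\<close> in the
  cone. If the estimate failed, then on the thin rectangle of the points
  \<open>x + p (y - x) + q (k1 + k2)\<close> a penalized version of \<open>\<phi>\<close> would attain its maximum at a point
  from which one can move in the directions \<open>- k1\<close> and \<open>k2\<close>; adding the two resulting
  inequalities for the derivatives bounds \<open>L (y - x) = L k1 - L k2\<close> from below by more than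
  its norm.\<close>

lemma increment_le:
  assumes x: "x \<in> V" and y: "y \<in> V"
  shows "\<phi> y - \<phi> x \<le> norm (blinfun_apply S (y - x))"
proof (rule ccontr)
  define e where "e = y - x"
  define N where "N = norm (blinfun_apply S e)"
  define \<Delta> where "\<Delta> = \<phi> y - \<phi> x - N"
  assume "\<not> ?thesis"
  then have \<Delta>: "\<Delta> > 0" by (simp add: \<Delta>_def N_def e_def)
  \<comment> \<open>A slope halfway between \<open>N\<close> and the supposed increment
    \<open>N + \<Delta>\<close> of \<open>\<phi>\<close>.\<close>
  define \<mu> where "\<mu> = N + \<Delta> / 2"
  define \<alpha> where "\<alpha> = (norm e + 1) / r"
  have \<alpha>: "0 < \<alpha>" "norm e < \<alpha> * r" using r by (auto simp: \<alpha>_def add_nonneg_pos)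
  define k1 where "k1 = \<alpha> *\<^sub>R u + e"
  define k2 where "k2 = \<alpha> *\<^sub>R u"
  define k where "k = (2 * \<alpha>) *\<^sub>R u + e"
  have k12: "k1 = (1/2) *\<^sub>R (k + e)" "k2 = (1/2) *\<^sub>R (k - e)" "e = k1 - k2"
    by (simp_all add: k1_def k2_def k_def scaleR_add_right flip: scaleR_add_left)
  define M where "M = norm (blinfun_apply S k)"
  obtain \<rho> where \<rho>: "\<rho> > 0" "ball x \<rho> \<subseteq> V" "ball y \<rho> \<subseteq> V"
  proof -
    obtain \<rho>1 \<rho>2 where "\<rho>1 > 0" "ball x \<rho>1 \<subseteq> V" "\<rho>2 > 0" "ball y \<rho>2 \<subseteq> V"
      using V(1) x y by (meson open_contains_ball)
    then show ?thesis by (intro that[of "min \<rho>1 \<rho>2"]) auto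
  qed
  define \<eta> where "\<eta> = \<rho> / (norm k + 1)"
  have \<eta>: "\<eta> > 0" "\<eta> * norm k < \<rho>"
    using \<rho>(1) by (auto simp: \<eta>_def field_simps add_nonneg_pos add_pos_nonneg)
  define v where "v p q = x + p *\<^sub>R e + q *\<^sub>R k" for p q
  have vV: "v p q \<in> V" if "0 \<le> p" "p \<le> 1" "\<bar>q\<bar> \<le> \<eta>" for p q
  proof -
    have "norm (q *\<^sub>R k) < \<rho>"
      using that(3) \<eta>(2) mult_right_mono[of "\<bar>q\<bar>" \<eta> "norm k"] by simp
    then have "x + q *\<^sub>R k \<in> V" "y + q *\<^sub>R k \<in> V"
      using \<rho> by (auto simp: dist_norm subset_iff)
    then have "(1 - p) *\<^sub>R (x + q *\<^sub>R k) + p *\<^sub>R (y + q *\<^sub>R k) \<in> V"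
      using V(2) that by (intro convexD) auto
    then show ?thesis by (simp add: v_def e_def algebra_simps)
  qed
  \<comment> \<open>The first summand of this penalty coefficient excludes a maximum on the sides
    \<open>\<bar>q\<bar> = \<eta>\<close>, the second on the side \<open>p = 0\<close>.\<close>
  define K where "K = (M + 1) / \<eta> + M\<^sup>2 / \<Delta>"
  have M: "0 \<le> M" by (simp add: M_def)
  have K: "K > 0" "M < K * \<eta>" "M\<^sup>2 \<le> K * \<Delta>"
  proof -
    show "K > 0" using M \<eta> \<Delta> by (auto simp: K_def intro!: add_pos_nonneg)
    have "M + 1 \<le> K * \<eta>" using \<eta> \<Delta> by (simp add: K_def field_simps)
    then show "M < K * \<eta>" by simp
    show "M\<^sup>2 \<le> K * \<Delta>" using M \<eta> \<Delta> by (simp add: K_def field_simps)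
  qed
  define G where "G p q = \<phi> (v p q) - \<mu> * p - K * q\<^sup>2" for p q
  have slope: "\<phi> (v p q) \<le> \<phi> (v p 0) + M * \<bar>q\<bar>" if "0 \<le> p" "p \<le> 1" "\<bar>q\<bar> \<le> \<eta>" for p q
  proof -
    have "\<bar>\<phi> (v p 0 + q *\<^sub>R k) - \<phi> (v p 0)\<bar> \<le> \<bar>q\<bar> * norm (blinfun_apply S k)"
      using that vV[of p 0] vV[of p q] \<eta>(1) \<alpha> r
      by (intro lipschitz_cone[where \<alpha> = "2 * \<alpha>" and h = e]) (auto simp: v_def k_def intro: less_trans)
    then show ?thesis by (simp add: v_def M_def mult.commute)
  qed
  have "continuous_on ({0..1} \<times> {-\<eta>..\<eta>}) (\<lambda>z. G (fst z) (snd z))"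
  proof -
    have "continuous_on ({0..1} \<times> {-\<eta>..\<eta>}) (\<lambda>z. v (fst z) (snd z))"
      unfolding v_def by (intro continuous_intros)
    then have "continuous_on ({0..1} \<times> {-\<eta>..\<eta>}) (\<lambda>z. \<phi> (v (fst z) (snd z)))"
      by (rule continuous_on_compose2[OF continuous_on]) (auto intro!: vV)
    then show ?thesis unfolding G_def by (intro continuous_intros)
  qed
  then have "\<exists>z\<in>{0..1} \<times> {-\<eta>..\<eta>}. \<forall>z'\<in>{0..1} \<times> {-\<eta>..\<eta>}. G (fst z') (snd z') \<le> G (fst z) (snd z)"
    using \<eta>(1) by (intro continuous_attains_sup compact_Times) auto
  then obtain p q where "p \<in> {0..1}" "q \<in> {-\<eta>..\<eta>}"
    and max_G: "\<forall>p'\<in>{0..1}. \<forall>q'\<in>{-\<eta>..\<eta>}. G p' q' \<le> G p q"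
    by auto
  then have pq: "0 \<le> p" "p \<le> 1" "\<bar>q\<bar> \<le> \<eta>" by auto
  have max: "G p' q' \<le> G p q" if "0 \<le> p'" "p' \<le> 1" "\<bar>q'\<bar> \<le> \<eta>" for p' q'
    using max_G that by (simp add: abs_le_iff)
  \<comment> \<open>Completing the square gives
    \<open>M * \<bar>q\<bar> - K * q\<^sup>2 \<le> \<Delta> / 4\<close>, while \<open>G 1 0\<close>
    exceeds \<open>\<phi> x\<close> by \<open>\<Delta> / 2\<close>.\<close>
  have "p \<noteq> 0"
  proof
    assume "p = 0"
    have "4 * (K * (M * \<bar>q\<bar>)) \<le> M\<^sup>2 + 4 * (K * (K * q\<^sup>2))"
      using zero_le_power2[of "2 * (K * \<bar>q\<bar>) - M"] by (simp add: power2_eq_square algebra_simps)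
    then have "K * (4 * (M * \<bar>q\<bar>) - 4 * (K * q\<^sup>2)) \<le> K * \<Delta>"
      using K(3) by (simp add: algebra_simps)
    then have "4 * (M * \<bar>q\<bar>) - 4 * (K * q\<^sup>2) \<le> \<Delta>" using K(1) by simp
    then have "G p q \<le> \<phi> x + \<Delta> / 4"
      using slope[OF pq] \<open>p = 0\<close> by (simp add: G_def v_def)
    moreover have "G 1 0 = \<phi> x + \<Delta> / 2" by (simp add: G_def v_def e_def \<mu>_def \<Delta>_def field_simps)
    ultimately show False using max[of 1 0] \<eta>(1) \<Delta> by simp
  qed
  then have p: "0 < p" using pq by simp
  have q: "\<bar>q\<bar> < \<eta>"
  proof (rule ccontr)
    assume "\<not> ?thesis"
    then have q\<eta>: "\<bar>q\<bar> = \<eta>" using pq by simp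
    then have "q\<^sup>2 = \<eta> * \<eta>" by (metis power2_abs power2_eq_square)
    then have "G p q \<le> G p 0 + (M - K * \<eta>) * \<eta>"
      using slope[OF pq] q\<eta> by (simp add: G_def algebra_simps)
    moreover have "(M - K * \<eta>) * \<eta> < 0" using K(2) \<eta>(1) by (simp add: mult_neg_pos)
    ultimately show False using max[of p 0] pq \<eta>(1) by simp
  qed
  \<comment> \<open>Moving along \<open>- k1\<close> or \<open>k2\<close> decreases
    \<open>p\<close>, so a maximum on the side \<open>p = 1\<close> does no harm.\<close>
  define d where "d = min (2 * p) (2 * (\<eta> - \<bar>q\<bar>))"
  have d: "0 < d" using p q by (simp add: d_def)
  have vpq: "v p q \<in> V" using vV pq by blast
  have "- L (v p q) k1 + \<mu> / 2 + K * q \<le> 0"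
  proof (rule DERIV_nonpos_if_right_max[OF _ d])
    have "((\<lambda>t. \<phi> (v p q + t *\<^sub>R (- 1) *\<^sub>R k1)) has_real_derivative - 1 * L (v p q) k1) (at 0)"
      unfolding k1_def by (rule deriv_cone[OF vpq \<alpha>])
    moreover have "v p q + t *\<^sub>R (- 1) *\<^sub>R k1 = v (p - t / 2) (q - t / 2)" for t
      by (simp add: k12(1) v_def algebra_simps)
    ultimately have D: "((\<lambda>t. \<phi> (v (p - t / 2) (q - t / 2))) has_real_derivative - L (v p q) k1) (at 0)"
      by simp
    show "((\<lambda>t. G (p - t / 2) (q - t / 2)) has_real_derivative - L (v p q) k1 + \<mu> / 2 + K * q) (at 0)"
    proof -
      have "((\<lambda>t. \<mu> * (p - t / 2)) has_real_derivative - (\<mu> / 2)) (at 0)"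
        "((\<lambda>t. K * (q - t / 2)\<^sup>2) has_real_derivative - (K * q)) (at 0)"
        by (auto intro!: derivative_eq_intros)
      from DERIV_diff[OF DERIV_diff[OF D this(1)] this(2)] show ?thesis by (simp add: G_def)
    qed
    fix \<tau> :: real assume "0 < \<tau>" "\<tau> < d"
    then have "0 < \<tau> / 2" "\<tau> / 2 < p" "\<tau> / 2 < \<eta> - \<bar>q\<bar>" by (auto simp: d_def)
    then have "G (p - \<tau> / 2) (q - \<tau> / 2) \<le> G p q"
      using pq by (intro max) linarith+
    then show "G (p - \<tau> / 2) (q - \<tau> / 2) \<le> G (p - 0 / 2) (q - 0 / 2)" by simp
  qed
  moreover have "L (v p q) k2 + \<mu> / 2 - K * q \<le> 0"
  proof (rule DERIV_nonpos_if_right_max[OF _ d])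
    have "((\<lambda>t. \<phi> (v p q + t *\<^sub>R k2)) has_real_derivative L (v p q) k2) (at 0)"
      using deriv_cone[OF vpq \<alpha>(1), of 0 1] \<alpha>(1) r by (simp add: k2_def)
    moreover have "v p q + t *\<^sub>R k2 = v (p - t / 2) (q + t / 2)" for t
      by (simp add: k12(2) v_def algebra_simps)
    ultimately have D: "((\<lambda>t. \<phi> (v (p - t / 2) (q + t / 2))) has_real_derivative L (v p q) k2) (at 0)"
      by simp
    show "((\<lambda>t. G (p - t / 2) (q + t / 2)) has_real_derivative L (v p q) k2 + \<mu> / 2 - K * q) (at 0)"
    proof -
      have "((\<lambda>t. \<mu> * (p - t / 2)) has_real_derivative - (\<mu> / 2)) (at 0)"
        "((\<lambda>t. K * (q + t / 2)\<^sup>2) has_real_derivative K * q) (at 0)"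
        by (auto intro!: derivative_eq_intros)
      from DERIV_diff[OF DERIV_diff[OF D this(1)] this(2)] show ?thesis by (simp add: G_def)
    qed
    fix \<tau> :: real assume "0 < \<tau>" "\<tau> < d"
    then have "0 < \<tau> / 2" "\<tau> / 2 < p" "\<tau> / 2 < \<eta> - \<bar>q\<bar>" by (auto simp: d_def)
    then have "G (p - \<tau> / 2) (q + \<tau> / 2) \<le> G p q"
      using pq by (intro max) linarith+
    then show "G (p - \<tau> / 2) (q + \<tau> / 2) \<le> G (p - 0 / 2) (q + 0 / 2)" by simp
  qed
  \<comment> \<open>The penalty terms \<open>K * q\<close> cancel when the two inequalities are
    added.\<close>
  moreover have "L (v p q) e = L (v p q) k1 - L (v p q) k2"
    unfolding k12(3) by (rule linear_diff[OF linear[OF vpq]])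
  ultimately have "\<mu> \<le> L (v p q) e" by simp
  also have "\<dots> \<le> N" using bound[OF vpq, of e] by (simp add: N_def)
  finally show False using \<Delta> by (simp add: \<mu>_def)
qed

end

section \<open>From the factorization to the derivative\<close>

lemma eventually_translate_subset_open:
  fixes U :: "'a::real_normed_vector set"
  assumes U: "open U" "x \<in> U" and B: "bounded B"
  shows "\<forall>\<^sub>F \<epsilon> in at (0::real). \<forall>b\<in>B. x + \<epsilon> *\<^sub>R b \<in> U"
proof -
  obtain r where r: "r > 0" "ball x r \<subseteq> U" using U by (meson open_contains_ball)
  obtain M where M: "M > 0" "\<And>b. b \<in> B \<Longrightarrow> norm b \<le> M" using B by (auto simp: bounded_pos)
  have "\<forall>\<^sub>F \<epsilon> in at (0::real). \<bar>\<epsilon>\<bar> < r / M"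
    unfolding eventually_at using r M by (intro exI[of _ "r / M"]) auto
  then show ?thesis
  proof eventually_elim
    case (elim \<epsilon>)
    show ?case
    proof
      fix b assume "b \<in> B"
      then have "norm (\<epsilon> *\<^sub>R b) \<le> \<bar>\<epsilon>\<bar> * M" using M by (auto intro: mult_left_mono)
      also have "\<dots> < r" using elim M by (simp add: field_simps)
      finally show "x + \<epsilon> *\<^sub>R b \<in> U"
        using r(2)[THEN subsetD, of "x + \<epsilon> *\<^sub>R b"] by (simp add: dist_norm)
    qed
  qed
qed

text \<open>Removes \<open>Z\<close> and \<open>g\<close> from the argument: \<open>D x\<close> is
  \<open>g'\<close> at \<open>S x\<close> composed with \<open>S\<close>, so boundedness of
  \<open>g'\<close> becomes domination of \<open>D x\<close> by \<open>S\<close>.\<close>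

lemma factorizesE:
  fixes f :: "'a::banach \<Rightarrow> 'b::banach"
  assumes fac: "factorizes TYPE('z::banach) \<B> p U f" and U: "open U" and \<B>: "\<And>B. B \<in> \<B> \<Longrightarrow> bounded B"
  obtains S :: "'a \<Rightarrow>\<^sub>L 'z::banach" and D :: "'a \<Rightarrow> 'a \<Rightarrow>\<^sub>L 'b" where
    "p_convergent p S"
    "\<And>B. U_bounded U B \<Longrightarrow> \<exists>C\<ge>0. \<forall>x\<in>B. \<forall>h. norm (blinfun_apply (D x) h) \<le> C * norm (blinfun_apply S h)"
    "\<And>x B. x \<in> U \<Longrightarrow> B \<in> \<B> \<Longrightarrow>
       uniform_limit B (\<lambda>\<epsilon> b. (f (x + \<epsilon> *\<^sub>R b) - f x - blinfun_apply (D x) (\<epsilon> *\<^sub>R b)) /\<^sub>R \<epsilon>) (\<lambda>_. 0) (at 0)"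
proof -
  obtain Z :: "'z set" and S :: "'a \<Rightarrow>\<^sub>L 'z" and g :: "'z \<Rightarrow> 'b" and g' :: "'z \<Rightarrow> 'z \<Rightarrow> 'b" where
    SZ: "range (blinfun_apply S) \<subseteq> Z" and pc: "p_convergent p S"
    and fg: "\<forall>x\<in>U. f x = g (blinfun_apply S x)"
    and der: "\<forall>x\<in>U. has_M_derivative Z (blinfun_apply S ` U) ((\<lambda>B. blinfun_apply S ` B) ` \<B>) g
                  (blinfun_apply S x) (g' (blinfun_apply S x))"
    and bd: "\<forall>B. U_bounded U B \<longrightarrow>
           (\<exists>C. \<forall>z \<in> blinfun_apply S ` B. \<forall>w\<in>Z. norm (g' z w) \<le> C * norm w)"
    using fac unfolding factorizes_def by (elim exE conjE) (rule that; assumption)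
  define D where "D x = Blinfun (\<lambda>h. g' (blinfun_apply S x) (blinfun_apply S h))" for x
  have D: "blinfun_apply (D x) h = g' (blinfun_apply S x) (blinfun_apply S h)" if x: "x \<in> U" for x h
  proof -
    have bl: "bounded_linear_on Z (g' (blinfun_apply S x))"
      using bspec[OF der x] by (simp add: has_M_derivative_def)
    then obtain C where C: "\<And>w. w \<in> Z \<Longrightarrow> norm (g' (blinfun_apply S x) w) \<le> C * norm w"
      unfolding bounded_linear_on_def by blast
    have "bounded_linear (\<lambda>h. g' (blinfun_apply S x) (blinfun_apply S h))"
    proof (rule bounded_linear_intro)
      fix h
      have "norm (g' (blinfun_apply S x) (blinfun_apply S h)) \<le> C * norm (blinfun_apply S h)"
        using SZ by (intro C) auto
      also have "\<dots> \<le> \<bar>C\<bar> * (norm S * norm h)"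
        by (intro mult_mono norm_blinfun) auto
      finally show "norm (g' (blinfun_apply S x) (blinfun_apply S h)) \<le> norm h * (\<bar>C\<bar> * norm S)"
        by (simp add: mult_ac)
    qed (use bl SZ in \<open>auto simp: bounded_linear_on_def blinfun.add_right blinfun.scaleR_right image_subset_iff\<close>)
    then show ?thesis by (simp add: D_def bounded_linear_Blinfun_apply)
  qed
  show ?thesis
  proof (rule that[of S D])
    fix B assume B: "U_bounded U B"
    obtain C where C: "\<And>x w. x \<in> B \<Longrightarrow> w \<in> Z \<Longrightarrow> norm (g' (blinfun_apply S x) w) \<le> C * norm w"
      using bd[rule_format, OF B] by blast
    have "norm (blinfun_apply (D x) h) \<le> \<bar>C\<bar> * norm (blinfun_apply S h)" if "x \<in> B" for x h
    proof -
      have "x \<in> U" using that B by (auto simp: U_bounded_def)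
      then have "norm (blinfun_apply (D x) h) \<le> C * norm (blinfun_apply S h)"
        using C[OF that, of "blinfun_apply S h"] SZ D by auto
      also have "\<dots> \<le> \<bar>C\<bar> * norm (blinfun_apply S h)" by (intro mult_right_mono) auto
      finally show ?thesis .
    qed
    then show "\<exists>C\<ge>0. \<forall>x\<in>B. \<forall>h. norm (blinfun_apply (D x) h) \<le> C * norm (blinfun_apply S h)"
      by (intro exI[of _ "\<bar>C\<bar>"]) auto
  next
    fix x B assume x: "x \<in> U" and B: "B \<in> \<B>"
    have inU: "\<forall>\<^sub>F \<epsilon> in at (0::real). \<forall>b\<in>B. x + \<epsilon> *\<^sub>R b \<in> U"
      by (rule eventually_translate_subset_open[OF U x \<B>[OF B]])
    have lim: "uniform_limit (blinfun_apply S ` B) (\<lambda>\<epsilon> y. (g (blinfun_apply S x + \<epsilon> *\<^sub>R y) - g (blinfun_apply S x)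
        - g' (blinfun_apply S x) (\<epsilon> *\<^sub>R y)) /\<^sub>R \<epsilon>) (\<lambda>_. 0) (at 0)"
      using bspec[OF der x] B by (auto simp: has_M_derivative_def)
    show "uniform_limit B (\<lambda>\<epsilon> b. (f (x + \<epsilon> *\<^sub>R b) - f x - blinfun_apply (D x) (\<epsilon> *\<^sub>R b)) /\<^sub>R \<epsilon>) (\<lambda>_. 0) (at 0)"
    proof (rule uniform_limitI)
      fix e :: real assume "e > 0"
      from uniform_limitD[OF lim this] inU
      show "\<forall>\<^sub>F \<epsilon> in at 0. \<forall>b\<in>B.
          dist ((f (x + \<epsilon> *\<^sub>R b) - f x - blinfun_apply (D x) (\<epsilon> *\<^sub>R b)) /\<^sub>R \<epsilon>) 0 < e"
        by eventually_elim (simp add: fg x D[OF x] blinfun.add_right blinfun.scaleR_right[of S])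
    qed
  qed (rule pc)
qed

text \<open>What the converse direction retains of the factorization. The family \<open>\<B>\<close>
  may be larger than that of the U-bounded sets, so that both choices of it are treated at
  once.\<close>

locale factorization =
  fixes f :: "'a::banach \<Rightarrow> 'b::banach" and U :: "'a set" and p :: ereal
    and S :: "'a \<Rightarrow>\<^sub>L 'z::banach" and D :: "'a \<Rightarrow> 'a \<Rightarrow>\<^sub>L 'b" and \<B> :: "'a set set"
  assumes U: "open U" "convex U"
    and p_convergent: "p_convergent p S"
    and D_bounded: "U_bounded U B \<Longrightarrow> \<exists>C\<ge>0. \<forall>x\<in>B. \<forall>h. norm (blinfun_apply (D x) h) \<le> C * norm (blinfun_apply S h)"
    and \<B>: "U_bounded U B \<Longrightarrow> B \<in> \<B>"
    and D_limit: "x \<in> U \<Longrightarrow> B \<in> \<B> \<Longrightarrow>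
       uniform_limit B (\<lambda>\<epsilon> b. (f (x + \<epsilon> *\<^sub>R b) - f x - blinfun_apply (D x) (\<epsilon> *\<^sub>R b)) /\<^sub>R \<epsilon>) (\<lambda>_. 0) (at 0)"
begin

text \<open>Singletons in \<open>U\<close> are U-bounded, so \<open>D_limit\<close> contains
  differentiability in every direction that is a point of \<open>U\<close>.\<close>

lemma functional_deriv:
  fixes \<psi> :: "'b \<Rightarrow>\<^sub>L real"
  assumes "x \<in> U" "b \<in> U"
  shows "((\<lambda>t. blinfun_apply \<psi> (f (x + t *\<^sub>R b))) has_real_derivative
    blinfun_apply \<psi> (blinfun_apply (D x) b)) (at 0)"
proof -
  obtain n where "b \<in> exhaustion U n" using exhaustion_UN U(1) assms(2) by blast
  then have "U_bounded U {b}"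
    using U_bounded_mono[OF U_bounded_exhaustion[OF U(1)]] by auto
  then have "((\<lambda>\<epsilon>. (f (x + \<epsilon> *\<^sub>R b) - f x - blinfun_apply (D x) (\<epsilon> *\<^sub>R b)) /\<^sub>R \<epsilon>) \<longlongrightarrow> 0) (at 0)"
    using tendsto_uniform_limitI[OF D_limit[OF assms(1) \<B>]] by blast
  then have "((\<lambda>\<epsilon>. blinfun_apply \<psi> ((f (x + \<epsilon> *\<^sub>R b) - f x - blinfun_apply (D x) (\<epsilon> *\<^sub>R b)) /\<^sub>R \<epsilon>))
      \<longlongrightarrow> 0) (at 0)"
    by (rule bounded_linear.tendsto_zero[OF blinfun.bounded_linear_right])
  then have "((\<lambda>\<epsilon>. (blinfun_apply \<psi> (f (x + \<epsilon> *\<^sub>R b)) - blinfun_apply \<psi> (f x)) / \<epsilon>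
      - blinfun_apply \<psi> (blinfun_apply (D x) b)) \<longlongrightarrow> 0) (at 0)"
    by (rule Lim_transform_eventually)
       (auto simp: eventually_at_filter blinfun.diff_right blinfun.scaleR_right intro!: always_eventually,
        simp add: field_simps)
  then show ?thesis by (simp add: DERIV_def LIM_zero_iff)
qed

text \<open>A norming functional reduces this to \<open>increment_le\<close>. The directions form a
  ball around \<open>x\<close> inside \<open>U\<close>, and the domain is the interior of a larger
  exhaustion set, which is convex and U-bounded.\<close>

lemma lipschitz_wrt_S:
  assumes B: "U_bounded U B"
  shows "\<exists>C\<ge>0. \<forall>x\<in>B. \<forall>y\<in>B. norm (f y - f x) \<le> C * norm (blinfun_apply S (y - x))"
proof -
  obtain n where n: "B \<subseteq> exhaustion U n" using U_bounded_subset_exhaustion[OF B] .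
  define E where "E = exhaustion U (2 * n + 2)"
  have BE: "B \<subseteq> interior E" using n exhaustion_subset_interior unfolding E_def by blast
  have EU: "interior E \<subseteq> U" using exhaustion_subset interior_subset unfolding E_def by blast
  obtain C where C: "C \<ge> 0"
    "\<And>x h. x \<in> E \<Longrightarrow> norm (blinfun_apply (D x) h) \<le> C * norm (blinfun_apply S h)"
    using D_bounded[OF U_bounded_exhaustion[OF U(1)]] unfolding E_def by meson
  have "norm (f y - f x) \<le> C * norm (blinfun_apply S (y - x))" if xy: "x \<in> B" "y \<in> B" for x y
  proof -
    obtain r where r: "r > 0" "ball x r \<subseteq> U"
      using U(1) xy BE EU by (meson open_contains_ball subsetD)
    obtain \<psi> :: "'b \<Rightarrow>\<^sub>L real" where \<psi>: "norm \<psi> \<le> 1" "blinfun_apply \<psi> (f y - f x) = norm (f y - f x)"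
      using norming_functional by blast
    interpret cone_differentiable "interior E" x r "\<lambda>x. blinfun_apply \<psi> (f x)"
      "\<lambda>x h. blinfun_apply \<psi> (blinfun_apply (D x) h)" "C *\<^sub>R S"
    proof (rule cone_differentiable.intro)
      show "convex (interior E)" using convex_exhaustion U(2) by (auto simp: E_def)
      show "linear (\<lambda>h. blinfun_apply \<psi> (blinfun_apply (D v) h))" if "v \<in> interior E" for v
        by (intro linearI) (auto simp: blinfun.add_right blinfun.scaleR_right)
      show "\<bar>blinfun_apply \<psi> (blinfun_apply (D v) h)\<bar> \<le> norm (blinfun_apply (C *\<^sub>R S) h)"
        if "v \<in> interior E" for v h
      proof -
        have "\<bar>blinfun_apply \<psi> (blinfun_apply (D v) h)\<bar> \<le> norm \<psi> * norm (blinfun_apply (D v) h)"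
          using norm_blinfun[of \<psi> "blinfun_apply (D v) h"] by simp
        also have "\<dots> \<le> 1 * norm (blinfun_apply (D v) h)"
          by (intro mult_right_mono \<psi>) auto
        also have "\<dots> \<le> C * norm (blinfun_apply S h)"
          using C(2)[OF subsetD[OF interior_subset that]] by simp
        finally show ?thesis using C(1) by (simp add: blinfun.scaleR_left)
      qed
      show "((\<lambda>t. blinfun_apply \<psi> (f (v + t *\<^sub>R b))) has_real_derivative
          blinfun_apply \<psi> (blinfun_apply (D v) b)) (at 0)" if "v \<in> interior E" "b \<in> ball x r" for v b
        by (rule functional_deriv[OF subsetD[OF EU that(1)] subsetD[OF r(2) that(2)]])
    qed (use r in auto)
    show ?thesis
      using increment_le[of x y] xy BE \<psi>(2) C(1) by (simp add: blinfun.diff_right[of \<psi>] blinfun.scaleR_left subset_iff)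
  qed
  then show ?thesis using C(1) by blast
qed

text \<open>Otherwise two strictly increasing index sequences, found by dependent choice, keep the
  values of \<open>f\<close> apart; but the differences of the points are weakly p-summable, so
  \<open>S\<close> sends them to 0, and \<open>lipschitz_wrt_S\<close> gives a
  contradiction.\<close>

lemma weakly_p_sequentially_continuous: "weakly_p_sequentially_continuous p U f"
  unfolding weakly_p_sequentially_continuous_def
proof (intro allI impI)
  fix x :: "nat \<Rightarrow> 'a" assume x: "U_bounded U (range x)" and cauchy: "weakly_p_Cauchy p x"
  obtain C where C: "C \<ge> 0" "\<And>m n. norm (f (x m) - f (x n)) \<le> C * norm (blinfun_apply S (x m - x n))"
    using lipschitz_wrt_S[OF x] by blast
  have "Cauchy (\<lambda>n. f (x n))"
  proof (rule ccontr)
    assume "\<not> ?thesis"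
    then obtain e where e: "e > 0" "\<And>N. \<exists>m\<ge>N. \<exists>n\<ge>N. e \<le> dist (f (x m)) (f (x n))"
      unfolding Cauchy_def by (meson not_le)
    define P where "P k q \<longleftrightarrow> e \<le> dist (f (x (fst q))) (f (x (snd q)))" for k :: nat and q
    define Q where "Q k q q' \<longleftrightarrow> fst q < fst q' \<and> snd q < snd q'" for k :: nat and q q' :: "nat \<times> nat"
    have "\<exists>s. \<forall>k. P k (s k) \<and> Q k (s k) (s (Suc k))"
    proof (rule dependent_nat_choice)
      show "\<exists>q. P 0 q" using e(2)[of 0] by (auto simp: P_def)
      show "\<exists>q'. P (Suc k) q' \<and> Q k q q'" for q k
      proof -
        obtain m n where "m \<ge> Suc (max (fst q) (snd q))" "n \<ge> Suc (max (fst q) (snd q))"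
          "e \<le> dist (f (x m)) (f (x n))" using e(2) by blast
        then show ?thesis by (intro exI[of _ "(m, n)"]) (auto simp: P_def Q_def)
      qed
    qed
    then obtain s where s: "\<And>k. e \<le> dist (f (x (fst (s k)))) (f (x (snd (s k))))"
      "\<And>k. fst (s k) < fst (s (Suc k))" "\<And>k. snd (s k) < snd (s (Suc k))"
      by (auto simp: P_def Q_def)
    have "strict_mono (\<lambda>k. fst (s k))" "strict_mono (\<lambda>k. snd (s k))"
      using s by (auto simp: strict_mono_Suc_iff)
    then have "weakly_p_summable p (\<lambda>k. x (fst (s k)) - x (snd (s k)))"
      using cauchy unfolding weakly_p_Cauchy_def by blast
    then have "(\<lambda>k. norm (blinfun_apply S (x (fst (s k)) - x (snd (s k))))) \<longlonglongrightarrow> 0"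
      using p_convergent unfolding p_convergent_def by blast
    then have "(\<lambda>k. C * norm (blinfun_apply S (x (fst (s k)) - x (snd (s k))))) \<longlonglongrightarrow> 0"
      by (rule tendsto_mult_right_zero)
    then have "\<forall>\<^sub>F k in sequentially. C * norm (blinfun_apply S (x (fst (s k)) - x (snd (s k)))) < e"
      using e(1) by (rule order_tendstoD)
    then obtain k where "C * norm (blinfun_apply S (x (fst (s k)) - x (snd (s k)))) < e"
      using eventually_happens by force
    then show False using s(1)[of k] C(2)[of "fst (s k)" "snd (s k)"] by (simp add: dist_norm)
  qed
  then show "convergent (\<lambda>n. f (x n))" by (simp add: Cauchy_convergent_iff)
qed

text \<open>The single p-convergent operator \<open>S\<close> dominates, up to a constant, all
  \<open>D x\<close> with \<open>x\<close> in \<open>B\<close>.\<close>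

lemma uniformly_p_convergent:
  assumes B: "U_bounded U B"
  shows "uniformly_p_convergent p (D ` B)"
  unfolding uniformly_p_convergent_def
proof (intro allI impI)
  fix x :: "nat \<Rightarrow> 'a" assume "weakly_p_summable p x"
  then have "(\<lambda>n. norm (blinfun_apply S (x n))) \<longlonglongrightarrow> 0"
    using p_convergent unfolding p_convergent_def by blast
  obtain C where C: "\<And>x h. x \<in> B \<Longrightarrow> norm (blinfun_apply (D x) h) \<le> C * norm (blinfun_apply S h)"
    using D_bounded[OF B] by blast
  have "(\<lambda>n. ennreal (C * norm (blinfun_apply S (x n)))) \<longlonglongrightarrow> ennreal 0"
    by (intro tendsto_ennrealI tendsto_mult_right_zero) fact
  then have lim: "(\<lambda>n. ennreal (C * norm (blinfun_apply S (x n)))) \<longlonglongrightarrow> 0" by simp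
  show "(\<lambda>n. SUP T\<in>D ` B. ennreal (norm (blinfun_apply T (x n)))) \<longlonglongrightarrow> 0"
    by (rule tendsto_sandwich[OF _ _ tendsto_const lim])
       (auto intro!: always_eventually SUP_least ennreal_leI C)
qed

text \<open>Directions that the sets in \<open>\<B>\<close> miss are reached by approximation, since \<open>f\<close> is locally
  Lipschitz by \<open>lipschitz_wrt_S\<close>.\<close>

lemma has_derivative:
  assumes dirs: "\<And>\<delta>. 0 < \<delta> \<Longrightarrow>
      \<exists>B\<in>\<B>. \<exists>K. \<forall>h. norm h \<le> 1 \<longrightarrow> (\<exists>c. \<exists>b\<in>B. \<bar>c\<bar> \<le> K \<and> norm (h - c *\<^sub>R b) \<le> \<delta>)"
    and x: "x \<in> U"
  shows "(f has_derivative blinfun_apply (D x)) (at x)"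
  unfolding has_derivative_at_alt
proof (intro conjI allI impI blinfun.bounded_linear_right)
  fix e :: real assume e: "e > 0"
  obtain n where "x \<in> exhaustion U n" using exhaustion_UN U(1) x by blast
  then obtain \<rho> where \<rho>: "\<rho> > 0" "ball x \<rho> \<subseteq> exhaustion U (2 * n + 2)"
    using exhaustion_subset_interior mem_interior by blast
  obtain C where C: "C \<ge> 0" "\<And>y z. y \<in> ball x \<rho> \<Longrightarrow> z \<in> ball x \<rho> \<Longrightarrow>
      norm (f y - f z) \<le> C * norm (blinfun_apply S (y - z))"
    using lipschitz_wrt_S[OF U_bounded_mono[OF U_bounded_exhaustion[OF U(1)] \<rho>(2)]] by blast
  \<comment> \<open>Bounds the error made in \<open>f\<close> and in \<open>D x\<close> together
    when \<open>h\<close> is replaced by \<open>\<epsilon> *\<^sub>R b\<close>.\<close>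
  define A where "A = C * norm S + norm (D x)"
  have A: "A \<ge> 0" using C(1) by (simp add: A_def)
  define \<delta> where "\<delta> = min 1 (e / (2 * (A + 1)))"
  have \<delta>: "0 < \<delta>" "\<delta> \<le> 1" "A * \<delta> \<le> e / 2"
  proof -
    show "0 < \<delta>" "\<delta> \<le> 1" using e A by (auto simp: \<delta>_def)
    have "A * \<delta> \<le> A * (e / (2 * (A + 1)))" by (intro mult_left_mono) (auto simp: \<delta>_def A)
    also have "\<dots> \<le> (A + 1) * (e / (2 * (A + 1)))" using e A by (intro mult_right_mono) auto
    also have "\<dots> = e / 2" using A by (simp add: field_simps)
    finally show "A * \<delta> \<le> e / 2" .
  qed
  obtain B K where B: "B \<in> \<B>"
    "\<And>h. norm h \<le> 1 \<Longrightarrow> \<exists>c. \<exists>b\<in>B. \<bar>c\<bar> \<le> K \<and> norm (h - c *\<^sub>R b) \<le> \<delta>"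
    using dirs[OF \<delta>(1)] by blast
  have K: "K \<ge> 0" using B(2)[of 0] by force
  \<comment> \<open>The divisor compensates for \<open>\<epsilon>\<close>, which can be as large as
    \<open>K\<close> times \<open>norm h\<close>.\<close>
  define e' where "e' = e / (2 * (K + 1))"
  have e': "e' > 0" "e' * K \<le> e / 2" using e K by (auto simp: e'_def field_simps)
  obtain d0 where d0: "d0 > 0" "\<And>\<epsilon> b. \<epsilon> \<noteq> 0 \<Longrightarrow> \<bar>\<epsilon>\<bar> < d0 \<Longrightarrow> b \<in> B \<Longrightarrow>
      norm ((f (x + \<epsilon> *\<^sub>R b) - f x - blinfun_apply (D x) (\<epsilon> *\<^sub>R b)) /\<^sub>R \<epsilon>) < e'"
    using uniform_limitD[OF D_limit[OF x B(1)] e'(1)] unfolding eventually_at by auto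
  \<comment> \<open>Half of \<open>\<rho>\<close>, because \<open>\<epsilon> *\<^sub>R b\<close> can
    be twice as long as \<open>h\<close>.\<close>
  define d where "d = min (\<rho> / 2) (d0 / (K + 1))"
  have "d > 0" using \<rho>(1) d0(1) K by (simp add: d_def)
  moreover have "norm (f y - f x - blinfun_apply (D x) (y - x)) \<le> e * norm (y - x)" if y: "norm (y - x) < d" for y
  proof (cases "y = x")
    case True
    then show ?thesis by (simp add: blinfun.zero_right)
  next
    case False
    define h where "h = y - x"
    define \<tau> where "\<tau> = norm h"
    have \<tau>: "0 < \<tau>" "2 * \<tau> < \<rho>" "(K + 1) * \<tau> < d0"
      using False y K by (auto simp: \<tau>_def h_def d_def field_simps)
    obtain c b where cb: "b \<in> B" "\<bar>c\<bar> \<le> K" "norm ((1 / \<tau>) *\<^sub>R h - c *\<^sub>R b) \<le> \<delta>"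
      using B(2)[of "(1 / \<tau>) *\<^sub>R h"] \<tau>(1) by (auto simp: \<tau>_def)
    define \<epsilon> where "\<epsilon> = \<tau> * c"
    have \<epsilon>: "\<bar>\<epsilon>\<bar> \<le> \<tau> * K" using cb(2) \<tau>(1) by (simp add: \<epsilon>_def abs_mult)
    have "h - \<epsilon> *\<^sub>R b = \<tau> *\<^sub>R ((1 / \<tau>) *\<^sub>R h - c *\<^sub>R b)"
      using \<tau>(1) by (simp add: \<epsilon>_def scaleR_diff_right)
    then have near: "norm (h - \<epsilon> *\<^sub>R b) \<le> \<tau> * \<delta>" using cb(3) \<tau>(1) by simp
    have "norm (\<epsilon> *\<^sub>R b) \<le> \<tau> + \<tau> * \<delta>"
      using near norm_triangle_sub[of "\<epsilon> *\<^sub>R b" h] by (simp add: \<tau>_def norm_minus_commute)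
    also have "\<dots> \<le> 2 * \<tau>" using \<delta>(2) \<tau>(1) by simp
    finally have "norm (\<epsilon> *\<^sub>R b) < \<rho>" using \<tau>(2) by simp
    then have inball: "x + \<epsilon> *\<^sub>R b \<in> ball x \<rho>" by (simp add: dist_norm)
    have "norm h < \<rho>" using \<tau>(1,2) unfolding \<tau>_def by linarith
    then have inball': "y \<in> ball x \<rho>" by (simp add: dist_norm h_def norm_minus_commute)
    have 1: "norm (f (x + \<epsilon> *\<^sub>R b) - f x - blinfun_apply (D x) (\<epsilon> *\<^sub>R b)) \<le> e / 2 * \<tau>"
    proof (cases "\<epsilon> = 0")
      case True
      then show ?thesis using e \<tau>(1) by (simp add: blinfun.zero_right)
    next
      case False
      have "\<tau> * K < d0" using \<tau> K by (simp add: algebra_simps)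
      then have "norm ((f (x + \<epsilon> *\<^sub>R b) - f x - blinfun_apply (D x) (\<epsilon> *\<^sub>R b)) /\<^sub>R \<epsilon>) * \<bar>\<epsilon>\<bar> \<le> e' * \<bar>\<epsilon>\<bar>"
        using \<epsilon> by (intro mult_right_mono less_imp_le[OF d0(2)[OF False _ cb(1)]]) auto
      then have "norm (f (x + \<epsilon> *\<^sub>R b) - f x - blinfun_apply (D x) (\<epsilon> *\<^sub>R b)) \<le> e' * \<bar>\<epsilon>\<bar>"
        using False by (simp add: inverse_eq_divide pos_divide_le_eq)
      also have "\<dots> \<le> e' * (\<tau> * K)" using \<epsilon> e'(1) by (intro mult_left_mono) auto
      also have "\<dots> \<le> e / 2 * \<tau>" using mult_right_mono[OF e'(2), of \<tau>] \<tau>(1) by (simp add: mult_ac)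
      finally show ?thesis .
    qed
    have "norm (f y - f (x + \<epsilon> *\<^sub>R b)) \<le> C * norm (blinfun_apply S (y - (x + \<epsilon> *\<^sub>R b)))"
      by (rule C(2)[OF inball' inball])
    also have "\<dots> \<le> C * (norm S * norm (h - \<epsilon> *\<^sub>R b))"
      using norm_blinfun[of S "h - \<epsilon> *\<^sub>R b"] C(1) by (intro mult_left_mono) (auto simp: h_def diff_diff_eq)
    finally have 2: "norm (f y - f (x + \<epsilon> *\<^sub>R b)) \<le> C * norm S * norm (h - \<epsilon> *\<^sub>R b)" by (simp add: mult_ac)
    have 3: "norm (blinfun_apply (D x) (\<epsilon> *\<^sub>R b - h)) \<le> norm (D x) * norm (h - \<epsilon> *\<^sub>R b)"
      using norm_blinfun[of "D x" "\<epsilon> *\<^sub>R b - h"] by (simp add: norm_minus_commute)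
    have split: "f y - f x - blinfun_apply (D x) (y - x) =
        (f (x + \<epsilon> *\<^sub>R b) - f x - blinfun_apply (D x) (\<epsilon> *\<^sub>R b)) +
        ((f y - f (x + \<epsilon> *\<^sub>R b)) + blinfun_apply (D x) (\<epsilon> *\<^sub>R b - h))"
      by (simp add: h_def blinfun.diff_right)
    have "norm (f y - f x - blinfun_apply (D x) (y - x)) \<le> e / 2 * \<tau> + A * norm (h - \<epsilon> *\<^sub>R b)"
      using 1 2 3 norm_triangle_ineq[of "f (x + \<epsilon> *\<^sub>R b) - f x - blinfun_apply (D x) (\<epsilon> *\<^sub>R b)"
          "(f y - f (x + \<epsilon> *\<^sub>R b)) + blinfun_apply (D x) (\<epsilon> *\<^sub>R b - h)"]
        norm_triangle_ineq[of "f y - f (x + \<epsilon> *\<^sub>R b)" "blinfun_apply (D x) (\<epsilon> *\<^sub>R b - h)"]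
      unfolding split A_def distrib_right by linarith
    also have "\<dots> \<le> e / 2 * \<tau> + A * (\<tau> * \<delta>)" using near A by (intro add_left_mono mult_left_mono)
    also have "\<dots> \<le> e / 2 * \<tau> + e / 2 * \<tau>"
    proof -
      have "A * (\<tau> * \<delta>) = A * \<delta> * \<tau>" by simp
      then show ?thesis using mult_right_mono[OF \<delta>(3), of \<tau>] \<tau>(1) by linarith
    qed
    finally show ?thesis by (simp add: \<tau>_def h_def)
  qed
  ultimately show "\<exists>d>0. \<forall>y. norm (y - x) < d \<longrightarrow>
      norm (f y - f x - blinfun_apply (D x) (y - x)) \<le> e * norm (y - x)" by blast
qed

text \<open>Directions are built from a point of \<open>U\<close>, and differentiability is asserted
  only at such points; hence the premise that \<open>U\<close> is nonempty.\<close>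

lemma assertion_a:
  assumes "\<And>\<delta>. 0 < \<delta> \<Longrightarrow> U \<noteq> {} \<Longrightarrow>
      \<exists>B\<in>\<B>. \<exists>K. \<forall>h. norm h \<le> 1 \<longrightarrow> (\<exists>c. \<exists>b\<in>B. \<bar>c\<bar> \<le> K \<and> norm (h - c *\<^sub>R b) \<le> \<delta>)"
  shows "assertion_a p U f"
  unfolding assertion_a_def
  using has_derivative assms uniformly_p_convergent weakly_p_sequentially_continuous by blast

end

section \<open>Factorization through bounded functions\<close>

text \<open>Otherwise operators of norm above \<open>2 ^ k\<close> send vectors of norm at most
  \<open>(1/2) ^ k\<close> to vectors of norm at least 1, although such a geometric sequence of
  vectors is weakly p-summable.\<close>

lemma uniformly_p_convergent_imp_bounded:
  fixes K :: "('a::real_normed_vector \<Rightarrow>\<^sub>L 'b::real_normed_vector) set"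
  assumes p: "1 \<le> p" and K: "uniformly_p_convergent p K"
  obtains C where "0 \<le> C" "\<And>T. T \<in> K \<Longrightarrow> norm T \<le> C"
proof (rule ccontr)
  assume "\<not> thesis"
  then have unbounded: "\<exists>T\<in>K. 2 ^ k < norm T" for k :: nat
    using that[of "2 ^ k"] by (force simp: not_le)
  have "\<exists>T x. T \<in> K \<and> norm x \<le> (1/2) ^ k \<and> 1 \<le> norm (blinfun_apply T x)" for k :: nat
  proof -
    obtain T where T: "T \<in> K" "2 ^ k < norm T" using unbounded by blast
    obtain y where y: "2 ^ k * norm y < norm (blinfun_apply T y)"
      using norm_blinfun_bound[of "2 ^ k" T] T(2) by (meson not_le zero_le_numeral zero_le_power)
    then have "y \<noteq> 0" by (auto simp: blinfun.zero_right)
    then show ?thesis using T(1) y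
      by (intro exI[of _ T] exI[of _ "(1 / (2 ^ k * norm y)) *\<^sub>R y"])
         (simp add: blinfun.scaleR_right field_simps power_one_over)
  qed
  then obtain T x where T: "\<And>k. T k \<in> K" and x: "\<And>k. norm (x k) \<le> (1/2) ^ k"
    and ge: "\<And>k. 1 \<le> norm (blinfun_apply (T k) (x k))"
    by metis
  have "(\<lambda>n. SUP T\<in>K. ennreal (norm (blinfun_apply T (x n)))) \<longlonglongrightarrow> 0"
    using K weakly_p_summable_if_geometric[OF p x] unfolding uniformly_p_convergent_def by blast
  then have "\<forall>\<^sub>F n in sequentially. (SUP T\<in>K. ennreal (norm (blinfun_apply T (x n)))) < 1"
    by (rule order_tendstoD) simp
  then obtain n where n: "(SUP T\<in>K. ennreal (norm (blinfun_apply T (x n)))) < 1"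
    using eventually_happens by force
  have "1 \<le> ennreal (norm (blinfun_apply (T n) (x n)))" using ge by simp
  also have "\<dots> \<le> (SUP T\<in>K. ennreal (norm (blinfun_apply T (x n))))" by (rule SUP_upper[OF T])
  finally show False using n by simp
qed

lemma uniformly_p_convergentD:
  assumes "uniformly_p_convergent p K" "weakly_p_summable p x" "0 < e"
  shows "\<forall>\<^sub>F n in sequentially. \<forall>T\<in>K. norm (blinfun_apply T (x n)) < e"
proof -
  have "(\<lambda>n. SUP T\<in>K. ennreal (norm (blinfun_apply T (x n)))) \<longlonglongrightarrow> 0"
    using assms(1,2) unfolding uniformly_p_convergent_def by blast
  then have "\<forall>\<^sub>F n in sequentially. (SUP T\<in>K. ennreal (norm (blinfun_apply T (x n)))) < ennreal e"
    by (rule order_tendstoD) (use assms(3) in simp)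
  then show ?thesis
  proof eventually_elim
    case (elim n)
    show ?case
    proof
      fix T assume "T \<in> K"
      then have "ennreal (norm (blinfun_apply T (x n))) < ennreal e"
        by (rule le_less_trans[OF SUP_upper elim])
      then show "norm (blinfun_apply T (x n)) < e" by (simp add: ennreal_less_iff)
    qed
  qed
qed

text \<open>Every function on a discrete space is continuous, so \<open>linf\<close> consists of all
  bounded functions.\<close>

lemma bcontfun_discreteI:
  fixes f :: "'a discrete \<Rightarrow> 'b::real_normed_vector"
  assumes "\<And>x. norm (f x) \<le> b"
  shows "f \<in> bcontfun"
  using assms open_discrete
  by (intro bcontfun_normI) (auto simp: continuous_on_open_vimage)

text \<open>Up to a weight, \<open>g'(S(x))\<close> is the evaluation at \<open>x\<close>. Among the points with the same image
  under \<open>S\<close>, one of least level is chosen as the representative \<open>rep\<close>, so that the weight stays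
  bounded on \<open>U\<close>-bounded sets; this allows one to take the whole of \<open>\<ell>\<^sub>\<infinity>(X;Y)\<close> as \<open>Z\<close>.\<close>

lemma factorizes_if_uniformly_p_convergent:
  fixes f :: "'a::banach \<Rightarrow> 'b::banach" and f' :: "'a \<Rightarrow> 'a \<Rightarrow>\<^sub>L 'b"
  assumes U: "open U" "convex U" and p: "1 \<le> p"
    and der: "\<And>x. x \<in> U \<Longrightarrow> (f has_derivative blinfun_apply (f' x)) (at x)"
    and unif: "\<And>B. U_bounded U B \<Longrightarrow> uniformly_p_convergent p (f' ` B)"
    and \<B>: "\<And>B. B \<in> \<B> \<Longrightarrow> bounded B"
  shows "factorizes TYPE(('a, 'b) linf) \<B> p U f"
proof -
  have unif_ex: "uniformly_p_convergent p (f' ` exhaustion U n)" for n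
    by (rule unif[OF U_bounded_exhaustion[OF U(1)]])
  have "\<exists>C\<ge>0. \<forall>x\<in>exhaustion U n. norm (f' x) \<le> C" for n
    using uniformly_p_convergent_imp_bounded[OF p unif_ex[of n]] by (metis imageI)
  then obtain C where C: "\<And>n. 0 \<le> C n" "\<And>n x. x \<in> exhaustion U n \<Longrightarrow> norm (f' x) \<le> C n"
    by metis
  define lev where "lev x = (LEAST n. x \<in> exhaustion U n)" for x
  have lev: "x \<in> exhaustion U (lev x)" if "x \<in> U" for x
    using exhaustion_UN[OF U(1) that] LeastI unfolding lev_def by metis
  have lev_le: "lev x \<le> n" if "x \<in> exhaustion U n" for x n
    unfolding lev_def using that by (rule Least_le)
  \<comment> \<open>The factor \<open>1 + C n\<close> makes the weighted derivatives bounded, and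
    \<open>real n + 1\<close> makes them small at high levels.\<close>
  define w where "w n = (real n + 1) * (1 + C n)" for n
  have w: "1 \<le> w n" for n
    using mult_mono[of 1 "real n + 1" 1 "1 + C n"] C(1) by (simp add: w_def)
  then have w0: "0 < w n" for n by (rule less_le_trans[OF zero_less_one])
  define J where "J x h = (if x \<in> U then blinfun_apply (f' x) h /\<^sub>R w (lev x) else 0)" for x h
  have J_lev: "norm (J x h) \<le> norm h / (real (lev x) + 1)" if "x \<in> U" for x h
  proof -
    have "norm (blinfun_apply (f' x) h) \<le> norm (f' x) * norm h" by (rule norm_blinfun)
    also have "\<dots> \<le> (1 + C (lev x)) * norm h"
      using C(2)[OF lev[OF that]] by (intro mult_right_mono) auto
    finally have "norm (J x h) \<le> inverse (w (lev x)) * ((1 + C (lev x)) * norm h)"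
      using that w0[of "lev x"] by (simp add: J_def)
    also have "\<dots> = norm h / (real (lev x) + 1)"
      using C(1)[of "lev x"] by (simp add: w_def field_simps add_nonneg_eq_0_iff)
    finally show ?thesis .
  qed
  have J_le: "norm (J x h) \<le> norm h" for x h
  proof (cases "x \<in> U")
    case True
    have "norm h / (real (lev x) + 1) \<le> norm h / 1" by (intro divide_left_mono) auto
    then show ?thesis using J_lev[OF True, of h] by simp
  qed (simp add: J_def)
  define S0 :: "'a \<Rightarrow> ('a, 'b) linf" where "S0 h = Bcontfun (\<lambda>d. J (of_discrete d) h)" for h
  have S0: "apply_bcontfun (S0 h) d = J (of_discrete d) h" for h d
    unfolding S0_def by (subst Bcontfun_inverse) (auto intro!: bcontfun_discreteI J_le)
  have "bounded_linear S0"
  proof (rule bounded_linear_intro)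
    show "S0 (x + y) = S0 x + S0 y" for x y
      by (rule bcontfun_eqI) (simp add: S0 J_def blinfun.add_right scaleR_add_right)
    show "S0 (r *\<^sub>R x) = r *\<^sub>R S0 x" for r x
      by (rule bcontfun_eqI) (simp add: S0 J_def blinfun.scaleR_right)
    show "norm (S0 x) \<le> norm x * 1" for x
      by (rule norm_bound) (simp add: S0 J_le)
  qed
  then obtain S :: "'a \<Rightarrow>\<^sub>L ('a, 'b) linf" where "\<And>h. blinfun_apply S h = S0 h"
    using bounded_linear_Blinfun_apply by metis
  then have S: "apply_bcontfun (blinfun_apply S h) d = J (of_discrete d) h" for h d
    by (simp add: S0)

  have "p_convergent p S"
    unfolding p_convergent_def
  proof (intro allI impI)
    fix x :: "nat \<Rightarrow> 'a" assume x: "weakly_p_summable p x"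
    obtain R where R: "R > 0" "\<And>n. norm (x n) \<le> R"
      using weakly_p_summable_imp_bounded[OF p x] by (auto simp: bounded_pos)
    have "\<forall>\<^sub>F k in sequentially. norm (blinfun_apply S (x k)) < e" if e: "e > 0" for e
    proof -
      \<comment> \<open>Outside \<open>exhaustion U N\<close> the weight makes \<open>J\<close>
        small, as \<open>x\<close> is bounded; inside it uniform p-convergence applies.\<close>
      obtain N where "R / (e / 2) < real N" using reals_Archimedean2 by blast
      then have N: "R / (real N + 1) \<le> e / 2" using e by (simp add: field_simps)
      have "\<forall>\<^sub>F k in sequentially. \<forall>T\<in>f' ` exhaustion U N. norm (blinfun_apply T (x k)) < e / 2"
        using e by (intro uniformly_p_convergentD[OF unif_ex x]) simp
      then show ?thesis
      proof eventually_elim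
        case (elim k)
        have "norm (J t (x k)) \<le> e / 2" for t
        proof (cases "t \<in> U \<and> t \<notin> exhaustion U N")
          case True
          then have "N \<le> lev t" using lev exhaustion_mono by (meson nat_le_linear subsetD)
          then have "norm (x k) / (real (lev t) + 1) \<le> R / (real N + 1)"
            using R by (intro frac_le) auto
          then show ?thesis using J_lev[of t "x k"] True N by linarith
        next
          case False
          show ?thesis
          proof (cases "t \<in> U")
            case True
            have "norm (J t (x k)) = norm (blinfun_apply (f' t) (x k)) / w (lev t)"
              using True w0[of "lev t"] by (simp add: J_def divide_inverse mult.commute)
            also have "\<dots> \<le> norm (blinfun_apply (f' t) (x k)) / 1"
              using w w0 by (intro divide_left_mono) auto
            also have "\<dots> \<le> e / 2" using elim True False by force
            finally show ?thesis .
          qed (use e in \<open>simp add: J_def\<close>)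
        qed
        then have "norm (blinfun_apply S (x k)) \<le> e / 2" by (intro norm_bound) (simp add: S)
        then show ?case using e by simp
      qed
    qed
    then show "(\<lambda>k. norm (blinfun_apply S (x k))) \<longlonglongrightarrow> 0"
      by (intro tendsto_norm_zero) (auto simp: tendsto_iff)
  qed
  moreover
  \<comment> \<open>All \<open>f' t\<close> with \<open>t\<close> in \<open>U\<close> vanish at
    \<open>y - x\<close>, so \<open>f\<close> is constant on the segment from \<open>x\<close> to
    \<open>y\<close>, which lies in \<open>U\<close> by convexity.\<close>
  have f_eq: "f x = f y" if xy: "x \<in> U" "y \<in> U" "blinfun_apply S x = blinfun_apply S y" for x y
  proof -
    have zero: "blinfun_apply (f' t) (y - x) = 0" if "t \<in> U" for t
    proof -
      have "J t x = J t y" using S[of x "discrete t"] S[of y "discrete t"] xy(3)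
        by (simp add: discrete_inverse)
      then show ?thesis using that w0[of "lev t"] by (simp add: J_def blinfun.diff_right)
    qed
    have "((\<lambda>s. f (x + s *\<^sub>R (y - x))) has_derivative (\<lambda>h. 0)) (at s within {0..1})" if "s \<in> {0..1}" for s
    proof -
      have "(1 - s) *\<^sub>R x + s *\<^sub>R y \<in> U" using U(2) xy that by (intro convexD) auto
      then have "x + s *\<^sub>R (y - x) \<in> U" by (simp add: algebra_simps)
      then have "((\<lambda>s. f (x + s *\<^sub>R (y - x))) has_derivative
          (\<lambda>h. blinfun_apply (f' (x + s *\<^sub>R (y - x))) (h *\<^sub>R (y - x)))) (at s within {0..1})"
        by (intro has_derivative_compose[OF _ der]) (auto intro!: derivative_eq_intros)
      then show ?thesis
        using zero[OF \<open>x + s *\<^sub>R (y - x) \<in> U\<close>] by (simp add: blinfun.scaleR_right)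
    qed
    then obtain c where c: "\<forall>s\<in>{0..1}. f (x + s *\<^sub>R (y - x)) = c"
      using has_derivative_zero_constant[of "{0..1 :: real}"] by blast
    show ?thesis using bspec[OF c, of 0] bspec[OF c, of 1] by simp
  qed
  \<comment> \<open>By \<open>f_eq\<close>, \<open>f\<close> is invariant under translation by
    \<open>y - x\<close> near \<open>x\<close>. This makes \<open>g'\<close> on the range of
    \<open>S\<close> independent of the representative.\<close>
  have f'_eq: "f' x = f' y" if xy: "x \<in> U" "y \<in> U" "blinfun_apply S x = blinfun_apply S y" for x y
  proof -
    define V where "V = U \<inter> (\<lambda>z. z + (y - x)) -` U"
    have V: "open V"
      unfolding V_def using U(1) by (intro open_Int open_vimage continuous_intros)
    have "((\<lambda>z. f (z + (y - x))) has_derivative (\<lambda>h. blinfun_apply (f' y) h)) (at x)"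
      using der[OF xy(2)] by (intro has_derivative_compose[where g = f and f = "\<lambda>z. z + (y - x)"])
        (auto intro!: derivative_eq_intros)
    then have "(f has_derivative blinfun_apply (f' y)) (at x)"
    proof (rule has_derivative_transform_within_open[OF _ V])
      show "x \<in> V" using xy by (simp add: V_def)
      show "f (z + (y - x)) = f z" if "z \<in> V" for z
        using that xy(3) by (intro f_eq) (auto simp: V_def blinfun.add_right blinfun.diff_right)
    qed
    then have "blinfun_apply (f' x) = blinfun_apply (f' y)"
      using der[OF xy(1)] by (intro has_derivative_unique)
    then show ?thesis by (simp add: blinfun_apply_inject)
  qed
  define rep where "rep z = arg_min lev (\<lambda>x. x \<in> U \<and> blinfun_apply S x = z)" for z
  have rep: "rep (blinfun_apply S x) \<in> U" "blinfun_apply S (rep (blinfun_apply S x)) = blinfun_apply S x"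
    "lev (rep (blinfun_apply S x)) \<le> lev x" if "x \<in> U" for x
    using arg_min_nat_lemma[of "\<lambda>y. y \<in> U \<and> blinfun_apply S y = blinfun_apply S x" x lev] that
    unfolding rep_def by auto
  define g where "g z = f (rep z)" for z
  define g' where "g' z v = w (lev (rep z)) *\<^sub>R apply_bcontfun v (discrete (rep z))"
    for z and v :: "('a, 'b) linf"
  have g: "g (blinfun_apply S x) = f x" if "x \<in> U" for x
    unfolding g_def using rep[OF that] that by (intro f_eq)
  have g': "g' (blinfun_apply S x) (blinfun_apply S h) = blinfun_apply (f' x) h" if "x \<in> U" for x h
    using rep(1)[OF that] w0[of "lev (rep (blinfun_apply S x))"] f'_eq[OF rep(1)[OF that] that rep(2)[OF that]]
    by (simp add: g'_def S J_def discrete_inverse)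
  have g'_le: "norm (g' z v) \<le> w (lev (rep z)) * norm v" for z v
    using w0[of "lev (rep z)"] by (simp add: g'_def norm_bounded)
  have "has_M_derivative UNIV (blinfun_apply S ` U) ((\<lambda>B. blinfun_apply S ` B) ` \<B>) g
      (blinfun_apply S x) (g' (blinfun_apply S x))" if x: "x \<in> U" for x
    unfolding has_M_derivative_def
  proof (intro conjI ballI)
    show "bounded_linear_on UNIV (g' (blinfun_apply S x))"
      unfolding bounded_linear_on_def using g'_le by (auto simp: g'_def scaleR_add_right)
    fix A assume "A \<in> (\<lambda>B. blinfun_apply S ` B) ` \<B>"
    then obtain B where B: "B \<in> \<B>" "A = blinfun_apply S ` B" by blast
    have inU: "\<forall>\<^sub>F \<epsilon> in at (0::real). \<forall>b\<in>B. x + \<epsilon> *\<^sub>R b \<in> U"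
      by (rule eventually_translate_subset_open[OF U(1) x \<B>[OF B(1)]])
    then show "\<forall>\<^sub>F \<epsilon> in at (0::real). \<forall>a\<in>A. blinfun_apply S x + \<epsilon> *\<^sub>R a \<in> blinfun_apply S ` U"
      by eventually_elim (auto simp: B(2) blinfun.add_right[symmetric] blinfun.scaleR_right[symmetric])
    show "uniform_limit A (\<lambda>\<epsilon> y. (g (blinfun_apply S x + \<epsilon> *\<^sub>R y) - g (blinfun_apply S x)
        - g' (blinfun_apply S x) (\<epsilon> *\<^sub>R y)) /\<^sub>R \<epsilon>) (\<lambda>_. 0) (at 0)"
    proof (rule uniform_limitI)
      fix e :: real assume e: "e > 0"
      obtain M where M: "M > 0" "\<And>b. b \<in> B \<Longrightarrow> norm b \<le> M" using \<B>[OF B(1)] by (auto simp: bounded_pos)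
      have "e / (2 * M) > 0" using e M by simp
      then obtain d where d: "d > 0" "\<And>y. norm (y - x) < d \<Longrightarrow>
          norm (f y - f x - blinfun_apply (f' x) (y - x)) \<le> e / (2 * M) * norm (y - x)"
        using der[OF x] unfolding has_derivative_at_alt by blast
      have "\<forall>\<^sub>F \<epsilon> in at (0::real). \<forall>b\<in>B. x + \<epsilon> *\<^sub>R b \<in> ball x d"
        using d(1) by (intro eventually_translate_subset_open \<B>[OF B(1)]) auto
      moreover have "\<forall>\<^sub>F \<epsilon> in at (0::real). \<epsilon> \<noteq> 0" by (simp add: eventually_at_filter)
      ultimately show "\<forall>\<^sub>F \<epsilon> in at 0. \<forall>y\<in>A. dist ((g (blinfun_apply S x + \<epsilon> *\<^sub>R y) - g (blinfun_apply S x)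
        - g' (blinfun_apply S x) (\<epsilon> *\<^sub>R y)) /\<^sub>R \<epsilon>) 0 < e"
        using inU
      proof eventually_elim
        case (elim \<epsilon>)
        show ?case
        proof
          fix y assume "y \<in> A"
          then obtain b where b: "b \<in> B" "y = blinfun_apply S b" using B(2) by blast
          have Sb: "\<epsilon> *\<^sub>R y = blinfun_apply S (\<epsilon> *\<^sub>R b)"
            "blinfun_apply S x + blinfun_apply S (\<epsilon> *\<^sub>R b) = blinfun_apply S (x + \<epsilon> *\<^sub>R b)"
            by (simp_all add: b blinfun.add_right blinfun.scaleR_right)
          define r where "r = f (x + \<epsilon> *\<^sub>R b) - f x - blinfun_apply (f' x) (\<epsilon> *\<^sub>R b)"
          have "norm (\<epsilon> *\<^sub>R b) < d" using elim(1) b(1) by (auto simp: dist_norm)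
          then have "norm r \<le> e / (2 * M) * norm (\<epsilon> *\<^sub>R b)"
            using d(2)[of "x + \<epsilon> *\<^sub>R b"] by (simp add: r_def)
          also have "\<dots> \<le> e / (2 * M) * (\<bar>\<epsilon>\<bar> * M)"
            using e M b(1) by (intro mult_left_mono) (auto intro: mult_left_mono)
          also have "\<dots> < e * \<bar>\<epsilon>\<bar>" using e M elim(2) by simp
          finally have "norm r / \<bar>\<epsilon>\<bar> < e" using elim(2) by (simp add: field_simps)
          then have "norm (r /\<^sub>R \<epsilon>) < e" by (simp add: divide_inverse mult.commute)
          then show "dist ((g (blinfun_apply S x + \<epsilon> *\<^sub>R y) - g (blinfun_apply S x)
              - g' (blinfun_apply S x) (\<epsilon> *\<^sub>R y)) /\<^sub>R \<epsilon>) 0 < e"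
            using elim(3) b(1) x unfolding Sb r_def by (simp only: g g' dist_0_norm dist_commute[of _ 0])
        qed
      qed
    qed
  qed
  moreover
  have "\<exists>K. \<forall>z\<in>blinfun_apply S ` B. \<forall>v\<in>UNIV. norm (g' z v) \<le> K * norm v" if B: "U_bounded U B" for B
  proof -
    obtain N where N: "B \<subseteq> exhaustion U N" using U_bounded_subset_exhaustion[OF B] .
    \<comment> \<open>The sum of the weights up to \<open>N\<close> stands in for their maximum, the
      constants \<open>C n\<close> not being chosen monotone.\<close>
    have "norm (g' (blinfun_apply S x) v) \<le> sum w {..N} * norm v" if x: "x \<in> B" for x v
    proof -
      have xN: "x \<in> exhaustion U N" using N x by blast
      have "lev (rep (blinfun_apply S x)) \<le> N"
        using rep(3)[OF subsetD[OF exhaustion_subset xN]] lev_le[OF xN] by (rule order.trans)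
      then have "w (lev (rep (blinfun_apply S x))) \<le> sum w {..N}"
        using less_imp_le[OF w0] by (intro member_le_sum) auto
      then show ?thesis
        by (rule order.trans[OF g'_le mult_right_mono[OF _ norm_ge_zero]])
    qed
    then show ?thesis by blast
  qed
  ultimately show ?thesis
    unfolding factorizes_def
    by (intro exI[of _ UNIV] exI[of _ S] exI[of _ g] exI[of _ g'] conjI ballI allI impI
        subspace_UNIV closed_UNIV subset_UNIV g[symmetric]) blast+
qed

section \<open>Conclusions for the two families of sets of directions\<close>

lemma factorizes_imp_factorization:
  fixes f :: "'a::banach \<Rightarrow> 'b::banach"
  assumes fac: "factorizes TYPE('z::banach) \<B> p U f" and U: "open U" "convex U"
    and \<B>: "\<And>B. B \<in> \<B> \<Longrightarrow> bounded B" "\<And>B. U_bounded U B \<Longrightarrow> B \<in> \<B>"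
  obtains S :: "'a \<Rightarrow>\<^sub>L 'z::banach" and D where "factorization f U p S D \<B>"
proof -
  obtain S :: "'a \<Rightarrow>\<^sub>L 'z" and D :: "'a \<Rightarrow> 'a \<Rightarrow>\<^sub>L 'b" where
    "p_convergent p S"
    "\<And>B. U_bounded U B \<Longrightarrow> \<exists>C\<ge>0. \<forall>x\<in>B. \<forall>h. norm (blinfun_apply (D x) h) \<le> C * norm (blinfun_apply S h)"
    "\<And>x B. x \<in> U \<Longrightarrow> B \<in> \<B> \<Longrightarrow>
       uniform_limit B (\<lambda>\<epsilon> b. (f (x + \<epsilon> *\<^sub>R b) - f x - blinfun_apply (D x) (\<epsilon> *\<^sub>R b)) /\<^sub>R \<epsilon>) (\<lambda>_. 0) (at 0)"
    using factorizesE[OF fac U(1) \<B>(1)] by blast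
  then have "factorization f U p S D \<B>"
    using U \<B>(2) by (intro factorization.intro)
  then show ?thesis by (rule that)
qed

lemma factorizes_imp_weakly_p_sequentially_continuous:
  fixes f :: "'a::banach \<Rightarrow> 'b::banach"
  assumes "factorizes TYPE('z::banach) {B. U_bounded U B} p U f" "open U" "convex U"
  shows "weakly_p_sequentially_continuous p U f"
proof -
  obtain S :: "'a \<Rightarrow>\<^sub>L 'z" and D where "factorization f U p S D {B. U_bounded U B}"
    by (rule factorizes_imp_factorization[OF assms]) (auto simp: U_bounded_def bounded_off_boundary_def)
  then show ?thesis by (rule factorization.weakly_p_sequentially_continuous)
qed

lemma factorizes_zero_imp_assertion_a:
  fixes f :: "'a::banach \<Rightarrow> 'b::banach"
  assumes "factorizes TYPE('z::banach) {B. U_bounded U B} p U f" "open U" "convex U" and 0: "0 \<in> U"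
  shows "assertion_a p U f"
proof -
  obtain S :: "'a \<Rightarrow>\<^sub>L 'z" and D where "factorization f U p S D {B. U_bounded U B}"
    by (rule factorizes_imp_factorization[OF assms(1-3)]) (auto simp: U_bounded_def bounded_off_boundary_def)
  then show ?thesis
  proof (rule factorization.assertion_a)
    fix \<delta> :: real assume \<delta>: "0 < \<delta>"
    obtain B K where "U_bounded U B"
      "\<And>h. norm h \<le> 1 \<Longrightarrow> \<exists>c. \<exists>b\<in>B. \<bar>c\<bar> \<le> K \<and> norm (h - c *\<^sub>R b) = 0"
      using directions_U_bounded_zero[OF assms(2) 0] by blast
    then show "\<exists>B\<in>{B. U_bounded U B}. \<exists>K. \<forall>h. norm h \<le> 1 \<longrightarrow>
        (\<exists>c. \<exists>b\<in>B. \<bar>c\<bar> \<le> K \<and> norm (h - c *\<^sub>R b) \<le> \<delta>)"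
      using \<delta> by (metis less_imp_le mem_Collect_eq)
  qed
qed

text \<open>The sets of this family may lie outside \<open>U\<close>, which is what supplies
  approximations to every direction.\<close>

lemma factorizes_off_boundary_imp_assertion_a:
  fixes f :: "'a::banach \<Rightarrow> 'b::banach"
  assumes "factorizes TYPE('z::banach) {B. bounded_off_boundary U B} p U f" "open U" "convex U"
  shows "assertion_a p U f"
proof -
  obtain S :: "'a \<Rightarrow>\<^sub>L 'z" and D where "factorization f U p S D {B. bounded_off_boundary U B}"
    by (rule factorizes_imp_factorization[OF assms]) (auto simp: U_bounded_def bounded_off_boundary_def)
  then show ?thesis
  proof (rule factorization.assertion_a)
    fix \<delta> :: real assume \<delta>: "0 < \<delta>" and "U \<noteq> {}"
    then obtain u where "u \<in> U" by blast
    then obtain B K where "bounded_off_boundary U B"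
      "\<And>h. norm h \<le> 1 \<Longrightarrow> \<exists>c. \<exists>b\<in>B. \<bar>c\<bar> \<le> K \<and> norm (h - c *\<^sub>R b) \<le> \<delta>"
      using directions_off_boundary[OF assms(2,3) _ \<delta>] by blast
    then show "\<exists>B\<in>{B. bounded_off_boundary U B}. \<exists>K. \<forall>h. norm h \<le> 1 \<longrightarrow>
        (\<exists>c. \<exists>b\<in>B. \<bar>c\<bar> \<le> K \<and> norm (h - c *\<^sub>R b) \<le> \<delta>)"
      by blast
  qed
qed

lemma assertion_a_imp_factorizes:
  fixes f :: "'a::banach \<Rightarrow> 'b::banach"
  assumes "assertion_a p U f" "open U" "convex U" "1 \<le> p" "\<And>B. B \<in> \<B> \<Longrightarrow> bounded B"
  shows "factorizes TYPE(('a, 'b) linf) \<B> p U f"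
  using assms(1) factorizes_if_uniformly_p_convergent[OF assms(2-4)] assms(5)
  unfolding assertion_a_def by blast

text \<open>Two families occur because subsets of \<open>U\<close> give only directions in the cones
  of \<open>U\<close> and its negative: these suffice for sequential continuity, and for
  differentiability when \<open>0 \<in> U\<close>.\<close>

theorem theorem4p1:
  fixes f :: "'a::banach \<Rightarrow> 'b::banach" and U :: "'a set" and p :: ereal
  assumes "open U" and "convex U" and "1 \<le> p"
  shows
    "(assertion_a p U f \<longleftrightarrow>
        factorizes TYPE(('a, 'b) linf) {B. bounded_off_boundary U B} p U f) \<and>
     (factorizes TYPE('z::banach) {B. bounded_off_boundary U B} p U f \<longrightarrow> assertion_a p U f) \<and>
     (assertion_a p U f \<longrightarrow> factorizes TYPE(('a, 'b) linf) {B. U_bounded U B} p U f) \<and>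
     (0 \<in> U \<longrightarrow> factorizes TYPE('z) {B. U_bounded U B} p U f \<longrightarrow> assertion_a p U f) \<and>
     (factorizes TYPE('z) {B. U_bounded U B} p U f \<longrightarrow> weakly_p_sequentially_continuous p U f)"
proof (intro conjI iffI impI)
  show "factorizes TYPE(('a, 'b) linf) {B. bounded_off_boundary U B} p U f" if "assertion_a p U f"
    by (rule assertion_a_imp_factorizes[OF that assms]) (simp add: bounded_off_boundary_def)
  show "factorizes TYPE(('a, 'b) linf) {B. U_bounded U B} p U f" if "assertion_a p U f"
    by (rule assertion_a_imp_factorizes[OF that assms]) (simp add: U_bounded_def bounded_off_boundary_def)
  show "assertion_a p U f" if "factorizes TYPE(('a, 'b) linf) {B. bounded_off_boundary U B} p U f"
    by (rule factorizes_off_boundary_imp_assertion_a[OF that assms(1,2)])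
  show "assertion_a p U f" if "factorizes TYPE('z) {B. bounded_off_boundary U B} p U f"
    by (rule factorizes_off_boundary_imp_assertion_a[OF that assms(1,2)])
  show "assertion_a p U f" if "0 \<in> U" "factorizes TYPE('z) {B. U_bounded U B} p U f"
    by (rule factorizes_zero_imp_assertion_a[OF that(2) assms(1,2) that(1)])
  show "weakly_p_sequentially_continuous p U f" if "factorizes TYPE('z) {B. U_bounded U B} p U f"
    by (rule factorizes_imp_weakly_p_sequentially_continuous[OF that assms(1,2)])
qed

end
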